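(* Let $P$ be a poset of height $2$ that has a $k$-partite representation for some integer $k\geq 2$. Then \[ \mathrm{La}(n,P)=(1+o(1))\binom{n}{\lfloor n/2\rfloor}\qquad (n\to\infty). \]
   Context: For posets $P=(P,\le)$ and $P'=(P',\le')$, $P'$ is a (weak) subposet of $P$ if there is an injection $f\colon P'\to P$ such that $u\le' v$ implies $f(u)\le f(v)$. The height of a poset is the maximum size of a chain in it. A family $\mathcal{F}$ of subsets of $[n]=\{1,\dots,n\}$ is $P$-free if $P$ is not a weak subposet of $(\mathcal{F},\subseteq)$; $\mathrm{La}(n,P)$ is the largest size of a $P$-free family of subsets of $[n]$. A poset $P$ of height $2$ has a $k$-partite representation if there exist an integer $l$ and a family $\mathcal{P}\subseteq\binom{[l]}{k-1}\cup\binom{[l]}{k}$ such that (i) the poset $(\mathcal{P},\subseteq)$ contains $P$ as a weak subposet, and (ii) the $k$-uniform hypergraph $G(\mathcal{P})$ with vertex set $[l]$ and edge set $\mathcal{P}\cap\binom{[l]}{k}$ is $k$-partite (its vertex set can be partitioned into $k$ parts so that every edge meets each part in exactly one vertex). *)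

theory Defs
  imports Complex_Main
begin

definition poset_on :: "'a set \<Rightarrow> ('a \<Rightarrow> 'a \<Rightarrow> bool) \<Rightarrow> bool" where
  "poset_on A le \<longleftrightarrow> (\<forall>x\<in>A. le x x) \<and>
     (\<forall>x\<in>A. \<forall>y\<in>A. le x y \<and> le y x \<longrightarrow> x = y) \<and>
     (\<forall>x\<in>A. \<forall>y\<in>A. \<forall>z\<in>A. le x y \<and> le y z \<longrightarrow> le x z)"

definition weak_subposet ::
  "'a set \<Rightarrow> ('a \<Rightarrow> 'a \<Rightarrow> bool) \<Rightarrow> 'b set \<Rightarrow> ('b \<Rightarrow> 'b \<Rightarrow> bool) \<Rightarrow> bool" where
  "weak_subposet A le B le' \<longleftrightarrow> (\<exists>f. inj_on f A \<and> f ` A \<subseteq> B \<and>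
     (\<forall>u\<in>A. \<forall>v\<in>A. le u v \<longrightarrow> le' (f u) (f v)))"

definition is_chain :: "'a set \<Rightarrow> ('a \<Rightarrow> 'a \<Rightarrow> bool) \<Rightarrow> 'a set \<Rightarrow> bool" where
  "is_chain A le C \<longleftrightarrow> C \<subseteq> A \<and> (\<forall>x\<in>C. \<forall>y\<in>C. le x y \<or> le y x)"

definition height :: "'a set \<Rightarrow> ('a \<Rightarrow> 'a \<Rightarrow> bool) \<Rightarrow> nat" where
  "height A le = Max {card C | C. is_chain A le C}"

definition P_free :: "'a set \<Rightarrow> ('a \<Rightarrow> 'a \<Rightarrow> bool) \<Rightarrow> nat set set \<Rightarrow> bool" where
  "P_free A le F \<longleftrightarrow> \<not> weak_subposet A le F (\<subseteq>)"

definition La :: "nat \<Rightarrow> 'a set \<Rightarrow> ('a \<Rightarrow> 'a \<Rightarrow> bool) \<Rightarrow> nat" where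
  "La n A le = Max {card F | F. F \<subseteq> Pow {1..n} \<and> P_free A le F}"

text \<open>k-partite representation. The partition of [l] into k parts is given by a
  colouring c : [l] \<rightarrow> {0..<k}; part i is {x. c x = i}.\<close>
definition has_kpartite_rep :: "'a set \<Rightarrow> ('a \<Rightarrow> 'a \<Rightarrow> bool) \<Rightarrow> nat \<Rightarrow> bool" where
  "has_kpartite_rep A le k \<longleftrightarrow> (\<exists>(l::nat) (Pf::nat set set).
     Pf \<subseteq> {S. S \<subseteq> {1..l} \<and> (card S = k - 1 \<or> card S = k)} \<and>
     weak_subposet A le Pf (\<subseteq>) \<and>
     (\<exists>c::nat \<Rightarrow> nat. (\<forall>x\<in>{1..l}. c x < k) \<and>
        (\<forall>E\<in>Pf. card E = k \<longrightarrow> (\<forall>i<k. card {x\<in>E. c x = i} = 1))))"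

end

theory Submission
  imports Defs "HOL-Probability.Hoeffding" "HOL-Real_Asymp.Real_Asymp"
begin

text \<open>
  Let \<open>F\<close> be \<open>P\<close>-free in the layers \<open>\<bar>a - n/2\<bar> \<le> \<delta>n\<close>, and let \<open>X\<close> count its members on a random
  maximal chain, so that \<open>|F| / (n choose n/2) \<le> E X \<le> 1 + E (X choose 2)\<close>. As \<open>P\<close> has height 2, no
  set has \<open>M = 2|P|\<close> members of \<open>F\<close> below it and \<open>M\<close> members above it. Hence chains are bounded, and
  pairs \<open>A \<subset> B\<close> in \<open>F\<close> with \<open>|B - A| \<ge> 2\<close> contribute only \<open>O(\<delta>) + O(1/n)\<close> to the expectation: they
  mostly come from sets \<open>A \<union> {x}\<close> with many members above, hence few below, and such incidences are
  rare. So an excess of \<open>F\<close> over the middle layer yields two consecutive levels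
  of \<open>F\<close> spanning a positive fraction of all covering pairs. Blowing up one colour class at a time,
  as in Erdos' theorem on complete \<open>k\<close>-partite hypergraphs, then produces
  the full \<open>k\<close>-partite configuration on these two levels, and with it a copy of \<open>P\<close>. The count is made relative
  to \<open>|F|\<close> rather than to a whole level, whose share of \<open>F\<close> may tend to 0.
\<close>

section \<open>Blow-ups in families with many covering pairs\<close>

text \<open>There are at most \<open>Z\<close> values, so those below \<open>c * n / 2\<close> carry
  at most half of the required total; the rest must come from larger values, each at most
  \<open>n\<close>.\<close>

lemma card_large_values:
  fixes f :: "'b \<Rightarrow> real"
  assumes Y: "finite Y" and fn: "\<And>y. y \<in> Y \<Longrightarrow> f y \<le> n"
    and c: "c > 0" and n: "n > 0" and YZ: "real (card Y) \<le> Z"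
    and sum: "(\<Sum>y\<in>Y. f y) \<ge> c * n * Z"
  shows "real (card {y\<in>Y. f y \<ge> c * n / 2}) \<ge> c / 2 * Z"
proof -
  define Y' where "Y' = {y\<in>Y. f y \<ge> c * n / 2}"
  have "c * n * Z \<le> (\<Sum>y\<in>Y. f y)" by (rule sum)
  also have "\<dots> \<le> (\<Sum>y\<in>Y. c * n / 2 + (if y \<in> Y' then n else 0))"
    using c n fn unfolding Y'_def by (intro sum_mono) (auto intro: add_increasing)
  also have "\<dots> = real (card Y) * (c * n / 2) + real (card Y') * n"
  proof -
    have "Y \<inter> Y' = Y'" unfolding Y'_def by auto
    then show ?thesis using Y by (simp add: sum.distrib sum.If_cases Int_def)
  qed
  also have "\<dots> \<le> Z * (c * n / 2) + real (card Y') * n"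
    using YZ c n by (intro add_mono mult_right_mono) auto
  finally have "n * (c / 2 * Z) \<le> n * real (card Y')" by (simp add: algebra_simps)
  then show ?thesis using n unfolding Y'_def by simp
qed

text \<open>Double counting of pairs \<open>(X, y)\<close> with \<open>X\<close> a
  \<open>t\<close>-subset of \<open>R y\<close>, as in the Kovari-Sos-Turan argument: with
  \<open>n = card N\<close>, at least \<open>c / 2 * Z\<close> points \<open>y\<close> have
  \<open>(c * n / (2 * t)) ^ t\<close> such subsets, while there are at most \<open>n ^ t\<close>
  sets \<open>X\<close>. Density is measured against \<open>Z\<close>, an arbitrary upper bound on
  \<open>card Y\<close>.\<close>

lemma exists_common_neighbours:
  fixes R :: "'b \<Rightarrow> 'a set" and c Z :: real and t :: nat
  assumes N: "finite N" and Y: "finite Y" and RN: "\<And>y. y \<in> Y \<Longrightarrow> R y \<subseteq> N"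
    and c: "c > 0" and t: "t > 0" and YZ: "real (card Y) \<le> Z" and Z: "Z > 0"
    and sum: "(\<Sum>y\<in>Y. real (card (R y))) \<ge> c * real (card N) * Z"
    and large: "c * real (card N) \<ge> 2 * real t"
  shows "\<exists>X\<subseteq>N. card X = t \<and> real (card {y\<in>Y. X \<subseteq> R y}) \<ge> c / 2 * (c / (2 * t)) ^ t * Z"
proof (rule ccontr)
  assume contra: "\<not> ?thesis"
  define n where "n = real (card N)"
  define Y' where "Y' = {y\<in>Y. real (card (R y)) \<ge> c * n / 2}"
  define T where "T = {X. X \<subseteq> N \<and> card X = t}"
  have n: "n > 0" using large c t unfolding n_def by (smt (verit) mult_nonneg_nonneg of_nat_0_less_iff of_nat_0_le_iff mult_eq_0_iff)
  have finY': "finite Y'" and finT: "finite T" using Y N unfolding Y'_def T_def by auto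
  have cY': "c / 2 * Z \<le> real (card Y')"
    unfolding Y'_def
  proof (rule card_large_values[OF Y _ c n YZ])
    show "real (card (R y)) \<le> n" if "y \<in> Y" for y
      unfolding n_def using RN[OF that] N by (simp add: card_mono)
    show "c * n * Z \<le> (\<Sum>y\<in>Y. real (card (R y)))" using sum unfolding n_def .
  qed
  have "c / 2 * Z * (c * n / (2 * t)) ^ t \<le> (\<Sum>y\<in>Y'. (c * n / (2 * t)) ^ t)"
    using mult_right_mono[OF cY', of "(c * n / (2 * t)) ^ t"] c n by simp
  also have "\<dots> \<le> (\<Sum>y\<in>Y'. real (card {X\<in>T. X \<subseteq> R y}))"
  proof (rule sum_mono)
    fix y assume y: "y \<in> Y'"
    then have yY: "y \<in> Y" and ge: "real (card (R y)) \<ge> c * n / 2" unfolding Y'_def by auto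
    have fin: "finite (R y)" using RN[OF yY] N finite_subset by blast
    \<comment> \<open>The largeness of \<open>N\<close> enters here:
      \<open>c * n / 2 \<ge> t\<close> makes the lower bound \<open>(m / t) ^ t\<close> on
      \<open>m choose t\<close> available.\<close>
    have le: "t \<le> card (R y)" using ge large unfolding n_def by linarith
    have "{X\<in>T. X \<subseteq> R y} = {X. X \<subseteq> R y \<and> card X = t}" unfolding T_def using RN[OF yY] by auto
    then have card: "card {X\<in>T. X \<subseteq> R y} = card (R y) choose t" using fin by (simp add: n_subsets)
    have "(c * n / (2 * t)) ^ t \<le> (real (card (R y)) / real t) ^ t"
      using ge c n t by (intro power_mono) (auto simp: field_simps)
    also have "\<dots> \<le> real (card (R y) choose t)"
      using binomial_ge_n_over_k_pow_k[OF le, where ?'a = real] by simp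
    finally show "(c * n / (2 * t)) ^ t \<le> real (card {X\<in>T. X \<subseteq> R y})" using card by simp
  qed
  also have "\<dots> = (\<Sum>X\<in>T. real (card {y\<in>Y'. X \<subseteq> R y}))"
    unfolding of_nat_sum[symmetric]
    using sum_multicount_gen[OF finY' finT, of "\<lambda>y X. X \<subseteq> R y" "\<lambda>X. card {y\<in>Y'. X \<subseteq> R y}"]
    by simp
  also have "\<dots> < (\<Sum>X\<in>T. c / 2 * (c / (2 * t)) ^ t * Z)"
  proof (rule sum_strict_mono[OF finT])
    \<comment> \<open>Strictness of the sum needs some candidate \<open>X\<close>; with none, the
      number of pairs would be zero, against its positive lower bound.\<close>
    show "T \<noteq> {}"
    proof
      assume "T = {}"
      then have "(\<Sum>X\<in>T. real (card {y\<in>Y'. X \<subseteq> R y})) = 0" by simp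
      moreover have "c / 2 * Z * (c * n / (2 * t)) ^ t > 0" using c Z n t by simp
      moreover have "(\<Sum>y\<in>Y'. real (card {X\<in>T. X \<subseteq> R y})) = 0" using \<open>T = {}\<close> by simp
      ultimately show False using \<open>c / 2 * Z * (c * n / (2 * t)) ^ t \<le> (\<Sum>y\<in>Y'. (c * n / (2 * t)) ^ t)\<close>
        \<open>(\<Sum>y\<in>Y'. (c * n / (2 * t)) ^ t) \<le> (\<Sum>y\<in>Y'. real (card {X\<in>T. X \<subseteq> R y}))\<close> by linarith
    qed
    fix X assume X: "X \<in> T"
    have "card {y\<in>Y'. X \<subseteq> R y} \<le> card {y\<in>Y. X \<subseteq> R y}"
      using Y unfolding Y'_def by (intro card_mono) auto
    moreover have "real (card {y\<in>Y. X \<subseteq> R y}) < c / 2 * (c / (2 * t)) ^ t * Z"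
      using contra X unfolding T_def by force
    ultimately show "real (card {y\<in>Y'. X \<subseteq> R y}) < c / 2 * (c / (2 * t)) ^ t * Z" by linarith
  qed
  also have "\<dots> = real (card N choose t) * (c / 2 * (c / (2 * t)) ^ t * Z)"
    unfolding T_def using N by (simp add: n_subsets)
  also have "\<dots> \<le> n ^ t * (c / 2 * (c / (2 * t)) ^ t * Z)"
  proof (rule mult_right_mono)
    have "card N choose t \<le> card N ^ t" 
    proof (cases "t \<le> card N")
      case True then show ?thesis by (rule binomial_le_pow)
    next
      case False then show ?thesis by (simp add: binomial_eq_0)
    qed
    then show "real (card N choose t) \<le> n ^ t" unfolding n_def
      by (metis of_nat_le_iff of_nat_power)
  qed (use c Z in auto)
  also have "\<dots> = c / 2 * Z * (c * n / (2 * t)) ^ t"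
    by (simp add: power_mult_distrib power_divide field_simps)
  finally show False by simp
qed

section \<open>Configurations with some coordinates blown up\<close>

text \<open>One edge of the sought configuration over a core \<open>D\<close>: the top set and its
  lower covers that drop an element of \<open>xs\<close>. The position in the list records the
  colour class of a vertex.\<close>

definition good :: "'a set set \<Rightarrow> 'a set \<Rightarrow> 'a list \<Rightarrow> bool" where
  "good G D xs \<longleftrightarrow> distinct xs \<and> D \<inter> set xs = {} \<and> D \<union> set xs \<in> G \<and>
     (\<forall>x\<in>set xs. D \<union> set xs - {x} \<in> G)"

text \<open>The first \<open>j\<close> coordinates are single vertices, the others range
  independently over the classes \<open>Xs\<close>. Free coordinates are used up from the end of
  \<open>xs\<close>, so a new class is put in front of \<open>Xs\<close>.\<close>

definition partial_good :: "'a set set \<Rightarrow> 'a set list \<Rightarrow> nat \<Rightarrow> ('a set \<times> 'a list) set" where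
  "partial_good G Xs j = {(D, xs). length xs = j \<and>
     (\<forall>ys. list_all2 (\<in>) ys Xs \<longrightarrow> good G D (xs @ ys))}"

lemma good_subset: "good G D xs \<Longrightarrow> G \<subseteq> Pow N \<Longrightarrow> D \<subseteq> N \<and> set xs \<subseteq> N"
  unfolding good_def by auto

lemma ex_transversal:
  assumes "\<forall>X\<in>set Xs. X \<noteq> {}" shows "\<exists>ys. list_all2 (\<in>) ys Xs"
  using assms
proof (induction Xs)
  case (Cons X Xs)
  then obtain ys x where "list_all2 (\<in>) ys Xs" "x \<in> X" by auto
  then have "list_all2 (\<in>) (x # ys) (X # Xs)" by simp
  then show ?case by blast
qed simp

text \<open>Non-empty classes supply a transversal; without one the condition in
  \<open>partial_good\<close> would be vacuous and would not confine \<open>D\<close> and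
  \<open>xs\<close> to \<open>N\<close>.\<close>

lemma partial_good_subset:
  assumes "G \<subseteq> Pow N" and "\<forall>X\<in>set Xs. X \<noteq> {}" 
  shows "partial_good G Xs j \<subseteq> Pow N \<times> {xs. set xs \<subseteq> N \<and> length xs = j}"
proof -
  obtain ys where "list_all2 (\<in>) ys Xs" using ex_transversal[OF assms(2)] by blast
  then have "good G D (xs @ ys)" if "(D, xs) \<in> partial_good G Xs j" for D xs
    using that unfolding partial_good_def by blast
  then show ?thesis using good_subset[OF _ assms(1)] unfolding partial_good_def by fastforce
qed

lemma finite_partial_good:
  assumes "finite N" "G \<subseteq> Pow N" "\<forall>X\<in>set Xs. X \<noteq> {}"
  shows "finite (partial_good G Xs j)"
  by (rule finite_subset[OF partial_good_subset[OF assms(2,3)]])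
     (use assms(1) finite_lists_length_eq[OF assms(1)] in auto)

text \<open>The last free vertex \<open>x\<close> is viewed as a neighbour of the configuration
  truncated before it, and \<open>t\<close> common neighbours form the new class. The density stays
  relative to \<open>card G\<close> because the truncated configurations number at most
  \<open>card G * card N ^ j\<close>.\<close>

lemma partial_good_step:
  fixes c :: real
  assumes N: "finite N" and G: "G \<subseteq> Pow N" and Gne: "G \<noteq> {}"
    and c: "c > 0" and t: "t > 0"
    and Xs: "\<forall>X\<in>set Xs. card X = t"
    and large: "c * real (card N) \<ge> 2 * real t"
    and dense: "real (card (partial_good G Xs (Suc j))) \<ge> c * real (card G) * real (card N) ^ Suc j"
  shows "\<exists>X. card X = t \<and>
     real (card (partial_good G (X # Xs) j)) \<ge> c / 2 * (c / (2 * t)) ^ t * real (card G) * real (card N) ^ j"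
proof -
  define S where "S = partial_good G Xs (Suc j)"
  define R where "R = (\<lambda>(D, xs). {x\<in>N. (D, xs @ [x]) \<in> S})"
  define Y where "Y = (\<lambda>(D, xs). (D, butlast xs)) ` S"
  have ne: "\<forall>X\<in>set Xs. X \<noteq> {}" using Xs t by auto
  \<comment> \<open>One fixed transversal is enough to encode the truncated configurations by
    members of \<open>G\<close> when they are counted.\<close>
  obtain ys where ys: "list_all2 (\<in>) ys Xs" using ex_transversal[OF ne] by blast
  have Ssub: "S \<subseteq> Pow N \<times> {xs. set xs \<subseteq> N \<and> length xs = Suc j}"
    unfolding S_def by (rule partial_good_subset[OF G ne])
  have finS: "finite S" unfolding S_def by (rule finite_partial_good[OF N G ne])
  then have finY: "finite Y" unfolding Y_def by simp
  have finG: "finite G" using G N by (simp add: finite_subset)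
  have Ylen: "length xs = j" if "(D, xs) \<in> Y" for D xs
    using that Ssub unfolding Y_def by auto
  have YS: "\<exists>x. x \<in> N \<and> (D, xs @ [x]) \<in> S" if y: "(D, xs) \<in> Y" for D xs
  proof -
    obtain zs where zs: "(D, zs) \<in> S" "xs = butlast zs" using y unfolding Y_def by fastforce
    then have "length zs = Suc j" "set zs \<subseteq> N" using Ssub by auto
    then have "zs = xs @ [last zs]" "last zs \<in> N" using zs(2)
      by (metis append_butlast_last_id length_0_conv nat.distinct(1), metis \<open>length zs = Suc j\<close> \<open>set zs \<subseteq> N\<close> last_in_set length_0_conv nat.distinct(1) subsetD)
    then show ?thesis using zs(1) by metis
  qed
  have cardS: "card S = (\<Sum>y\<in>Y. card (R y))"
  proof -
    have image: "S = (\<lambda>(y, x). (fst y, snd y @ [x])) ` (SIGMA y:Y. R y)"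
    proof (intro equalityI subsetI)
      fix z assume z: "z \<in> S"
      obtain D zs where zz: "z = (D, zs)" by (cases z)
      then have "length zs = Suc j" "set zs \<subseteq> N" using Ssub z by auto
      then obtain xs x where "zs = xs @ [x]" "x \<in> N" by (cases zs rule: rev_cases) auto
      then have "((D, xs), x) \<in> (SIGMA y:Y. R y)" using z zz unfolding Y_def R_def by force
      then show "z \<in> (\<lambda>(y, x). (fst y, snd y @ [x])) ` (SIGMA y:Y. R y)"
        using zz \<open>zs = xs @ [x]\<close> by force
    qed (auto simp: R_def)
    have inj: "inj_on (\<lambda>(y, x). (fst y, snd y @ [x])) (SIGMA y:Y. R y)"
      by (auto simp: inj_on_def)
    have "card S = card (SIGMA y:Y. R y)"
      using arg_cong[OF image, of card] card_image[OF inj] by (rule trans)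
    also have "\<dots> = (\<Sum>y\<in>Y. card (R y))" using finY N by (intro card_SigmaI) (auto simp: R_def)
    finally show ?thesis .
  qed
  \<comment> \<open>Deleting the variable coordinate from a good set leaves a member of \<open>G\<close>.\<close>
  have cardY: "card Y \<le> card G * card N ^ j"
  proof -
    define \<phi> where "\<phi> = (\<lambda>(D, xs). (D \<union> set xs \<union> set ys, xs))"
    have dis: "D \<inter> (set xs \<union> set ys) = {}" and mem: "D \<union> set xs \<union> set ys \<in> G" and sub: "set xs \<subseteq> N"
      if y: "(D, xs) \<in> Y" for D xs
    proof -
      obtain x where "(D, xs @ [x]) \<in> S" using YS[OF y] by blast
      then have g: "good G D (xs @ [x] @ ys)" using ys unfolding S_def partial_good_def by auto
      show "D \<inter> (set xs \<union> set ys) = {}" using g unfolding good_def by auto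
      have "D \<union> set (xs @ [x] @ ys) - {x} \<in> G" "distinct (xs @ [x] @ ys)" "x \<notin> D" using g unfolding good_def by auto
      moreover have "D \<union> set (xs @ [x] @ ys) - {x} = D \<union> set xs \<union> set ys"
        using calculation(2,3) by auto
      ultimately show "D \<union> set xs \<union> set ys \<in> G" by simp
      show "set xs \<subseteq> N" using good_subset[OF g G] by auto
    qed
    have "inj_on \<phi> Y"
    proof (rule inj_onI)
      fix y z assume yz: "y \<in> Y" "z \<in> Y" "\<phi> y = \<phi> z"
      obtain D xs D' xs' where eq: "y = (D, xs)" "z = (D', xs')" by (cases y, cases z)
      then have 1: "xs = xs'" "D \<union> set xs \<union> set ys = D' \<union> set xs \<union> set ys" using yz(3) unfolding \<phi>_def by auto
      have "D \<inter> (set xs \<union> set ys) = {}" "D' \<inter> (set xs \<union> set ys) = {}"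
        using dis yz eq 1 by auto
      then have "D = D'" using 1(2) by blast
      then show "y = z" using eq 1 by simp
    qed
    moreover have "\<phi> ` Y \<subseteq> G \<times> {xs. set xs \<subseteq> N \<and> length xs = j}"
      using mem sub Ylen unfolding \<phi>_def by fastforce
    ultimately have "card Y \<le> card (G \<times> {xs. set xs \<subseteq> N \<and> length xs = j})"
      using finG finite_lists_length_eq[OF N] by (intro card_inj_on_le) auto
    also have "\<dots> = card G * card N ^ j" using N by (simp add: card_cartesian_product card_lists_length_eq)
    finally show ?thesis .
  qed
  have Npos: "card N > 0" using large t c by (cases "card N") auto
  have Gpos: "card G > 0" using finG Gne by (simp add: card_gt_0_iff)
  have "\<exists>X\<subseteq>N. card X = t \<and> real (card {y\<in>Y. X \<subseteq> R y}) \<ge> c / 2 * (c / (2 * t)) ^ t * (real (card G) * real (card N) ^ j)"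
  proof (rule exists_common_neighbours[OF N finY _ c t _ _ _ large])
    show "real (card Y) \<le> real (card G) * real (card N) ^ j"
      using cardY by (metis of_nat_le_iff of_nat_mult of_nat_power)
    show "c * real (card N) * (real (card G) * real (card N) ^ j) \<le> (\<Sum>y\<in>Y. real (card (R y)))"
      using dense cardS unfolding S_def by (simp add: mult_ac)
    show "0 < real (card G) * real (card N) ^ j" using Npos Gpos by simp
  qed (auto simp: R_def)
  then obtain X where X: "X \<subseteq> N" "card X = t"
    "real (card {y\<in>Y. X \<subseteq> R y}) \<ge> c / 2 * (c / (2 * t)) ^ t * (real (card G) * real (card N) ^ j)" by blast
  have sub: "{y\<in>Y. X \<subseteq> R y} \<subseteq> partial_good G (X # Xs) j"
  proof
    fix y assume y: "y \<in> {y\<in>Y. X \<subseteq> R y}"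
    obtain D xs where eq: "y = (D, xs)" by (cases y)
    have "good G D (xs @ zs)" if "list_all2 (\<in>) zs (X # Xs)" for zs
    proof -
      obtain x ws where "zs = x # ws" "x \<in> X" "list_all2 (\<in>) ws Xs"
        using \<open>list_all2 (\<in>) zs (X # Xs)\<close> by (auto simp: list_all2_Cons2)
      moreover have "x \<in> R (D, xs)" using y \<open>x \<in> X\<close> unfolding eq by blast
      then have "(D, xs @ [x]) \<in> S" unfolding R_def by simp
      ultimately have "good G D ((xs @ [x]) @ ws)" unfolding S_def partial_good_def by simp
      then show ?thesis using \<open>zs = x # ws\<close> by simp
    qed
    moreover have "length xs = j" using y eq Ylen by blast
    ultimately show "y \<in> partial_good G (X # Xs) j" unfolding eq partial_good_def by simp
  qed
  have "finite (partial_good G (X # Xs) j)"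
    by (rule finite_partial_good[OF N G]) (use ne X(2) t in auto)
  then have "card {y\<in>Y. X \<subseteq> R y} \<le> card (partial_good G (X # Xs) j)" using sub by (rule card_mono)
  then have "real (card {y\<in>Y. X \<subseteq> R y}) \<le> real (card (partial_good G (X # Xs) j))" by simp
  then have "c / 2 * (c / (2 * t)) ^ t * real (card G) * real (card N) ^ j \<le> real (card (partial_good G (X # Xs) j))"
    using X(3) by (simp only: mult.assoc)
  then show ?thesis using X(2) by blast
qed

text \<open>The lists are counted by a falling factorial, each of whose \<open>k\<close> factors is
  at least \<open>r\<close>.\<close>

lemma card_distinct_lists_ge:
  fixes r :: real
  assumes "finite R" and "r \<ge> 0" and "r + real k \<le> real (card R)"
  shows "r ^ k \<le> real (card {xs. length xs = k \<and> distinct xs \<and> set xs \<subseteq> R})"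
proof -
  have k: "k \<le> card R" using assms by linarith
  have "r ^ k = (\<Prod>i\<in>{card R - k + 1..card R}. r)" using k by simp
  also have "\<dots> \<le> (\<Prod>i\<in>{card R - k + 1..card R}. real i)"
    using assms k by (intro prod_mono) (auto simp: of_nat_diff)
  finally show ?thesis using card_lists_distinct_length_eq[OF assms(1) k] by simp
qed

text \<open>Covering pairs inside \<open>G\<close> are compared with \<open>card N * card G\<close>,
  not with the size of full levels, so that a family with a vanishing share of its levels can still
  qualify.\<close>

definition dense_pairs :: "real \<Rightarrow> 'a set \<Rightarrow> 'a set set \<Rightarrow> bool" where
  "dense_pairs c N G \<longleftrightarrow> finite N \<and> G \<subseteq> Pow N \<and> G \<noteq> {} \<and>
     (\<Sum>B\<in>G. real (card {x\<in>B. B - {x} \<in> G})) \<ge> c * real (card N) * real (card G)"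

text \<open>If many elements of \<open>B\<close> can be removed one at a time without leaving
  \<open>G\<close>, then any \<open>k\<close> distinct ones of them, taken as \<open>xs\<close> with
  core \<open>B - set xs\<close>, are good; \<open>B\<close> and \<open>xs\<close> can be recovered
  from this pair.\<close>

lemma partial_good_Nil:
  fixes c :: real
  assumes "dense_pairs c N G" and c: "c > 0"
    and large: "c * real (card N) \<ge> 4 * real k" and Npos: "card N > 0"
  shows "real (card (partial_good G [] k)) \<ge> c / 2 * (c / 4) ^ k * real (card G) * real (card N) ^ k"
proof -
  have N: "finite N" and G: "G \<subseteq> Pow N" and Gne: "G \<noteq> {}"
    and dense: "(\<Sum>B\<in>G. real (card {x\<in>B. B - {x} \<in> G})) \<ge> c * real (card N) * real (card G)"
    using assms(1) unfolding dense_pairs_def by auto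
  define n where "n = real (card N)"
  define R where "R = (\<lambda>B. {x\<in>B. B - {x} \<in> G})"
  define G' where "G' = {B\<in>G. real (card (R B)) \<ge> c * n / 2}"
  define L where "L = (\<lambda>B. {xs. length xs = k \<and> distinct xs \<and> set xs \<subseteq> R B})"
  have n: "n > 0" using Npos unfolding n_def by simp
  have finG: "finite G" using G N by (simp add: finite_subset)
  have RN: "R B \<subseteq> N" if "B \<in> G" for B using that G unfolding R_def by auto
  have finR: "finite (R B)" if "B \<in> G" for B using RN[OF that] N finite_subset by blast
  have finL: "finite (L B)" if "B \<in> G" for B
    unfolding L_def using finite_lists_length_eq[OF finR[OF that], of k] by (rule rev_finite_subset) auto
  have G': "c / 2 * real (card G) \<le> real (card G')"
    unfolding G'_def
  proof (rule card_large_values[OF finG _ c n])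
    show "real (card (R B)) \<le> n" if "B \<in> G" for B
      unfolding n_def using RN[OF that] N by (simp add: card_mono)
    show "c * n * real (card G) \<le> (\<Sum>B\<in>G. real (card (R B)))" using dense unfolding n_def R_def .
  qed simp
  have "c / 2 * (c / 4) ^ k * real (card G) * n ^ k = (c / 2 * real (card G)) * (c * n / 4) ^ k"
    by (simp add: power_mult_distrib power_divide field_simps)
  also have "\<dots> \<le> real (card G') * (c * n / 4) ^ k"
    using G' c n by (intro mult_right_mono) auto
  also have "\<dots> = (\<Sum>B\<in>G'. (c * n / 4) ^ k)" by simp
  also have "\<dots> \<le> (\<Sum>B\<in>G'. real (card (L B)))"
  proof (rule sum_mono)
    fix B assume "B \<in> G'"
    then have B: "B \<in> G" "c * n / 2 \<le> real (card (R B))" unfolding G'_def by auto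
    \<comment> \<open>Setting \<open>k\<close> of the \<open>c * n / 2\<close> removable elements
      aside leaves at least half of them, because \<open>k \<le> c * n / 4\<close>.\<close>
    have "c * n / 4 + real k \<le> real (card (R B))" using B(2) large unfolding n_def by linarith
    then show "(c * n / 4) ^ k \<le> real (card (L B))"
      unfolding L_def using c n finR[OF B(1)] by (intro card_distinct_lists_ge) auto
  qed
  also have "\<dots> \<le> (\<Sum>B\<in>G. real (card (L B)))"
    using finG unfolding G'_def by (intro sum_mono2) auto
  also have "\<dots> = real (card (SIGMA B:G. L B))"
    using finG finL by (simp add: card_SigmaI)
  also have "\<dots> \<le> real (card (partial_good G [] k))"
  proof -
    define \<phi> where "\<phi> = (\<lambda>(B :: 'a set, xs). (B - set xs, xs))"
    have "inj_on \<phi> (SIGMA B:G. L B)"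
    proof (rule inj_onI)
      fix y z assume yz: "y \<in> (SIGMA B:G. L B)" "z \<in> (SIGMA B:G. L B)" "\<phi> y = \<phi> z"
      obtain B xs C zs where eq: "y = (B, xs)" "z = (C, zs)" by (cases y, cases z)
      have "xs = zs" "B - set xs = C - set xs" using yz(3) eq unfolding \<phi>_def by auto
      moreover have "set xs \<subseteq> B" "set zs \<subseteq> C" using yz eq unfolding L_def R_def by auto
      ultimately show "y = z" using eq by blast
    qed
    moreover have "\<phi> ` (SIGMA B:G. L B) \<subseteq> partial_good G [] k"
    proof
      fix z assume "z \<in> \<phi> ` (SIGMA B:G. L B)"
      then obtain B xs where B: "B \<in> G" "xs \<in> L B" "z = (B - set xs, xs)" unfolding \<phi>_def by auto
      have "B - set xs \<union> set xs = B" using B(2) unfolding L_def R_def by auto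
      then show "z \<in> partial_good G [] k"
        using B unfolding partial_good_def good_def L_def R_def by auto
    qed
    moreover have "finite (partial_good G [] k)" by (rule finite_partial_good[OF N G]) simp
    ultimately show ?thesis by (simp add: card_inj_on_le)
  qed
  finally show ?thesis unfolding n_def .
qed

text \<open>Each induction step adds one class and replaces the density constant by a smaller one.
  Constants and thresholds are chosen before \<open>N\<close> and \<open>G\<close>.\<close>

lemma dense_partial_good:
  fixes c :: real
  assumes c: "c > 0" and t: "t > 0" and "i \<le> k"
  shows "\<exists>c'>0. \<exists>n0. \<forall>(N::'a set) G. dense_pairs c N G \<longrightarrow> card N \<ge> n0 \<longrightarrow>
     (\<exists>Xs. length Xs = i \<and> (\<forall>X\<in>set Xs. card X = t) \<and>
        real (card (partial_good G Xs (k - i))) \<ge> c' * real (card G) * real (card N) ^ (k - i))"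
  using assms(3)
proof (induction i)
  case 0
  show ?case
  proof (intro exI conjI allI impI)
    show "c / 2 * (c / 4) ^ k > 0" using c by simp
    fix N :: "'a set" and G
    \<comment> \<open>The summand \<open>1\<close> in the threshold keeps \<open>N\<close> non-empty
      also when \<open>k = 0\<close>.\<close>
    assume dense: "dense_pairs c N G" and N: "nat \<lceil>4 * real k / c\<rceil> + 1 \<le> card N"
    have "4 * real k / c \<le> real (card N)" using N by linarith
    then have "c * real (card N) \<ge> 4 * real k" using c by (simp add: field_simps)
    then show "real (card (partial_good G [] (k - 0))) \<ge>
        c / 2 * (c / 4) ^ k * real (card G) * real (card N) ^ (k - 0)"
      using partial_good_Nil[OF dense c, of k] N by simp
  qed auto
next
  case (Suc i)
  have "i \<le> k" using Suc.prems by simp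
  from Suc.IH[OF this] obtain c' n0 where c': "c' > 0" and
    IH: "\<forall>(N::'a set) G. dense_pairs c N G \<longrightarrow> card N \<ge> n0 \<longrightarrow>
     (\<exists>Xs. length Xs = i \<and> (\<forall>X\<in>set Xs. card X = t) \<and>
        real (card (partial_good G Xs (k - i))) \<ge> c' * real (card G) * real (card N) ^ (k - i))"
    by (elim exE conjE) (rule that)
  have ki: "k - i = Suc (k - Suc i)" using Suc.prems by simp
  show ?case
  proof (rule exI[of _ "c' / 2 * (c' / (2 * t)) ^ t"], intro conjI exI[of _ "max n0 (nat \<lceil>2 * real t / c'\<rceil>)"] allI impI)
    show "c' / 2 * (c' / (2 * t)) ^ t > 0" using c' t by simp
    fix N :: "'a set" and G
    assume dense: "dense_pairs c N G" and N: "max n0 (nat \<lceil>2 * real t / c'\<rceil>) \<le> card N"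
    obtain Xs where Xs: "length Xs = i" "\<forall>X\<in>set Xs. card X = t"
      "real (card (partial_good G Xs (Suc (k - Suc i)))) \<ge> c' * real (card G) * real (card N) ^ Suc (k - Suc i)"
      using IH[rule_format, OF dense] N unfolding ki by auto
    have "2 * real t / c' \<le> real (card N)" using N by linarith
    then have large: "c' * real (card N) \<ge> 2 * real t" using c' by (simp add: field_simps)
    have N': "finite N" "G \<subseteq> Pow N" "G \<noteq> {}" using dense unfolding dense_pairs_def by auto
    from partial_good_step[OF N' c' t Xs(2) large Xs(3)] obtain X where
      "card X = t" "real (card (partial_good G (X # Xs) (k - Suc i))) \<ge>
        c' / 2 * (c' / (2 * t)) ^ t * real (card G) * real (card N) ^ (k - Suc i)" by blast
    then show "\<exists>Xs. length Xs = Suc i \<and> (\<forall>X\<in>set Xs. card X = t) \<and>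
        real (card (partial_good G Xs (k - Suc i))) \<ge>
          c' / 2 * (c' / (2 * t)) ^ t * real (card G) * real (card N) ^ (k - Suc i)"
      using Xs by (intro exI[of _ "X # Xs"]) auto
  qed
qed

text \<open>After \<open>k\<close> rounds no free coordinate is left, and a positive count yields
  one core \<open>D\<close> for which every transversal is good.\<close>

lemma ex_good_blowup:
  fixes c :: real
  assumes c: "c > 0" and t: "t > 0"
  shows "\<exists>n0. \<forall>(N::'a set) G. dense_pairs c N G \<longrightarrow> card N \<ge> n0 \<longrightarrow>
     (\<exists>D Xs. length Xs = k \<and> (\<forall>X\<in>set Xs. card X = t) \<and>
        (\<forall>ys. list_all2 (\<in>) ys Xs \<longrightarrow> good G D ys))"
proof -
  obtain c' n0 where c': "c' > 0" and n0: "\<forall>(N::'a set) G. dense_pairs c N G \<longrightarrow> card N \<ge> n0 \<longrightarrow>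
     (\<exists>Xs. length Xs = k \<and> (\<forall>X\<in>set Xs. card X = t) \<and>
        real (card (partial_good G Xs (k - k))) \<ge> c' * real (card G) * real (card N) ^ (k - k))"
    using dense_partial_good[OF c t order.refl[of k], where ?'a = 'a] by (elim exE conjE) (rule that)
  show ?thesis
  proof (intro exI[of _ n0] allI impI)
    fix N :: "'a set" and G
    assume dense: "dense_pairs c N G" and N: "n0 \<le> card N"
    obtain Xs where Xs: "length Xs = k" "\<forall>X\<in>set Xs. card X = t"
      "real (card (partial_good G Xs 0)) \<ge> c' * real (card G)"
      using n0[rule_format, OF dense N] by auto
    have "card G > 0" using dense by (auto simp: card_gt_0_iff dense_pairs_def finite_subset)
    then have "real (card (partial_good G Xs 0)) > 0"
      using Xs(3) mult_pos_pos[OF c', of "real (card G)"] by linarith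
    then have "partial_good G Xs 0 \<noteq> {}" by auto
    then obtain D where "(D, []) \<in> partial_good G Xs 0"
      by (auto simp: partial_good_def)
    then show "\<exists>D Xs. length Xs = k \<and> (\<forall>X\<in>set Xs. card X = t) \<and>
        (\<forall>ys. list_all2 (\<in>) ys Xs \<longrightarrow> good G D ys)"
      using Xs unfolding partial_good_def by auto
  qed
qed

section \<open>Embedding the poset\<close>

text \<open>A vertex shared by two classes could be chosen twice, giving a transversal with a
  repetition; a vertex of \<open>D\<close> in a class would give a transversal meeting
  \<open>D\<close>.\<close>

lemma good_blowup_disjoint:
  assumes good: "\<And>ys. list_all2 (\<in>) ys Xs \<Longrightarrow> good G D ys"
    and ne: "\<And>i. i < length Xs \<Longrightarrow> Xs ! i \<noteq> {}"
  shows "i < length Xs \<Longrightarrow> j < length Xs \<Longrightarrow> i \<noteq> j \<Longrightarrow> Xs ! i \<inter> Xs ! j = {}"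
    and "i < length Xs \<Longrightarrow> D \<inter> Xs ! i = {}"
proof -
  define a where "a = (\<lambda>i. SOME x. x \<in> Xs ! i)"
  have a: "a i \<in> Xs ! i" if "i < length Xs" for i
    unfolding a_def using ne[OF that] by (simp add: some_in_eq)
  have ok: "good G D (map b [0..<length Xs])" if "\<And>i. i < length Xs \<Longrightarrow> b i \<in> Xs ! i" for b
    by (rule good) (simp add: list_all2_conv_all_nth that)
  show "Xs ! i \<inter> Xs ! j = {}" if ij: "i < length Xs" "j < length Xs" "i \<noteq> j"
  proof (rule ccontr)
    assume "Xs ! i \<inter> Xs ! j \<noteq> {}"
    then obtain x where x: "x \<in> Xs ! i" "x \<in> Xs ! j" by auto
    have "good G D (map (a(i := x, j := x)) [0..<length Xs])"
      using x a by (intro ok) auto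
    then have "inj_on (a(i := x, j := x)) {0..<length Xs}" unfolding good_def by (simp add: distinct_map)
    then show False using ij unfolding inj_on_def by (metis atLeastLessThan_iff fun_upd_apply zero_le)
  qed
  show "D \<inter> Xs ! i = {}" if i: "i < length Xs"
  proof (rule ccontr)
    assume "D \<inter> Xs ! i \<noteq> {}"
    then obtain x where x: "x \<in> Xs ! i" "x \<in> D" by auto
    have "good G D (map (a(i := x)) [0..<length Xs])"
      using x a by (intro ok) auto
    then show False using x i unfolding good_def by (auto simp: disjoint_iff)
  qed
qed

text \<open>Vertices of colour \<open>i\<close> go injectively into class \<open>i\<close>, which
  has room for all of \<open>V\<close>. A rainbow set \<open>E\<close> then becomes a transversal,
  and goodness covers both its image and the images missing one vertex.\<close>

lemma ex_rainbow_embedding: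
  fixes V :: "'v set" and c :: "'v \<Rightarrow> nat"
  assumes good: "\<And>ys. list_all2 (\<in>) ys Xs \<Longrightarrow> good G D ys"
    and Xs: "length Xs = k" "\<forall>X\<in>set Xs. card X = t" and t: "t > 0"
    and V: "finite V" "card V \<le> t" and c: "\<And>v. v \<in> V \<Longrightarrow> c v < k"
  shows "\<exists>g. inj_on g V \<and> D \<inter> g ` V = {} \<and>
     (\<forall>E\<subseteq>V. (\<forall>i<k. card {x\<in>E. c x = i} = 1) \<longrightarrow>
        D \<union> g ` E \<in> G \<and> (\<forall>v\<in>E. D \<union> g ` (E - {v}) \<in> G))"
proof -
  have card: "card (Xs ! i) = t" if "i < k" for i using Xs that by auto
  have ne: "Xs ! i \<noteq> {}" if "i < length Xs" for i using card[of i] Xs(1) that t by auto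
  have disj: "Xs ! i \<inter> Xs ! j = {}" if "i < k" "j < k" "i \<noteq> j" for i j
    using good_blowup_disjoint(1)[OF good ne] that Xs(1) by auto
  have disj_D: "D \<inter> Xs ! i = {}" if "i < k" for i
    using good_blowup_disjoint(2)[OF good ne] that Xs(1) by auto
  have "\<exists>h. h ` {v\<in>V. c v = i} \<subseteq> Xs ! i \<and> inj_on h {v\<in>V. c v = i}" if "i < k" for i
  proof (rule card_le_inj)
    show "finite (Xs ! i)" using card[OF that] t card.infinite by fastforce
    show "card {v \<in> V. c v = i} \<le> card (Xs ! i)"
      using card_mono[OF V(1), of "{v\<in>V. c v = i}"] V(2) card[OF that] by simp
  qed (use V in auto)
  then have "\<forall>i. \<exists>h. i < k \<longrightarrow> h ` {v\<in>V. c v = i} \<subseteq> Xs ! i \<and> inj_on h {v\<in>V. c v = i}"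
    by blast
  from choice[OF this] obtain h where
    h: "\<And>i. i < k \<Longrightarrow> h i ` {v\<in>V. c v = i} \<subseteq> Xs ! i \<and> inj_on (h i) {v\<in>V. c v = i}"
    by blast
  define g where "g v = h (c v) v" for v
  have gX: "g v \<in> Xs ! c v" if "v \<in> V" for v
    using h[OF c[OF that]] that unfolding g_def by auto
  have inj: "inj_on g V"
  proof (rule inj_onI)
    fix u v assume uv: "u \<in> V" "v \<in> V" "g u = g v"
    have "c u = c v" using disj[OF c[OF uv(1)] c[OF uv(2)]] gX[OF uv(1)] gX[OF uv(2)] uv(3) by auto
    moreover have "inj_on (h (c u)) {w\<in>V. c w = c u}" using h[OF c[OF uv(1)]] by blast
    ultimately show "u = v" using uv unfolding g_def inj_on_def by auto
  qed
  have D: "D \<inter> g ` V = {}" using disj_D gX c by fastforce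
  have "D \<union> g ` E \<in> G \<and> (\<forall>v\<in>E. D \<union> g ` (E - {v}) \<in> G)"
    if E: "E \<subseteq> V" and rainbow: "\<forall>i<k. card {x\<in>E. c x = i} = 1" for E
  proof -
    have "\<forall>i<k. \<exists>x. {x\<in>E. c x = i} = {x}" using rainbow by (simp add: card_1_singleton_iff)
    \<comment> \<open>\<open>e i\<close> is the vertex of colour \<open>i\<close> in
      \<open>E\<close>; listing the images in the order of colours makes a transversal of
      \<open>Xs\<close>.\<close>
    then obtain e where e: "\<And>i. i < k \<Longrightarrow> {x\<in>E. c x = i} = {e i}" by metis
    have eE: "e i \<in> E" "c (e i) = i" if "i < k" for i using e[OF that] by auto
    have E_eq: "E = e ` {0..<k}"
    proof
      show "E \<subseteq> e ` {0..<k}"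
      proof
        fix x assume "x \<in> E"
        then have "x = e (c x)" "c x < k" using e[of "c x"] c E by auto
        then show "x \<in> e ` {0..<k}" by auto
      qed
    qed (use eE in auto)
    have "good G D (map (\<lambda>i. g (e i)) [0..<k])"
      using gX eE E Xs(1) by (intro good) (fastforce simp: list_all2_conv_all_nth)
    moreover have "set (map (\<lambda>i. g (e i)) [0..<k]) = g ` E" using E_eq by auto
    ultimately have "D \<union> g ` E \<in> G" "\<forall>x\<in>g ` E. D \<union> g ` E - {x} \<in> G"
      unfolding good_def by metis+
    moreover have "D \<union> g ` (E - {v}) = D \<union> g ` E - {g v}" if "v \<in> E" for v
    proof -
      have "g ` (E - {v}) = g ` E - {g v}" using inj that E by (auto simp: inj_on_def)
      moreover have "g v \<notin> D" using D that E by auto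
      ultimately show ?thesis by auto
    qed
    ultimately show ?thesis by auto
  qed
  then show ?thesis using inj D by blast
qed

lemma inj_on_extend:
  assumes "finite A" "finite F" "card A \<le> card F" "B \<subseteq> A" "inj_on f B" "f ` B \<subseteq> F"
  shows "\<exists>g. inj_on g A \<and> g ` A \<subseteq> F \<and> (\<forall>x\<in>B. g x = f x)"
proof -
  have "card (A - B) \<le> card (F - f ` B)"
    using assms by (simp add: card_Diff_subset finite_subset card_image)
  then obtain h where h: "h ` (A - B) \<subseteq> F - f ` B" "inj_on h (A - B)"
    using card_le_inj[of "A - B" "F - f ` B"] assms by auto
  define g where "g x = (if x \<in> B then f x else h x)" for x
  have "inj_on g A" using h assms(5) unfolding g_def inj_on_def by (auto; blast)
  moreover have "g ` A \<subseteq> F" using h assms unfolding g_def by auto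
  moreover have "\<forall>x\<in>B. g x = f x" by (simp add: g_def)
  ultimately show ?thesis by blast
qed

text \<open>The representation is copied into a blow-up inside \<open>G\<close>, every set being
  enlarged by the core \<open>D\<close>. Edges and their subsets of size \<open>k - 1\<close> land
  in \<open>G\<close>. A set of size \<open>k - 1\<close> below no edge may miss \<open>F\<close>,
  but then its poset element is isolated, and \<open>card A \<le> card F\<close> leaves a place for
  it.\<close>

lemma P_free_not_dense_pairs:
  fixes A :: "'a set" and c :: real
  assumes A: "finite A" and rep: "has_kpartite_rep A le k" and k: "k \<ge> 1" and c: "c > 0"
  shows "\<exists>n0. \<forall>N F G. P_free A le F \<longrightarrow> finite F \<longrightarrow> card A \<le> card F \<longrightarrow> G \<subseteq> F \<longrightarrow>
     card N \<ge> n0 \<longrightarrow> \<not> dense_pairs c N G"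
proof -
  from rep obtain Pf :: "nat set set" and l col where
    Pf: "Pf \<subseteq> {S. S \<subseteq> {1..l} \<and> (card S = k - 1 \<or> card S = k)}" and
    sub: "weak_subposet A le Pf (\<subseteq>)" and
    col: "\<forall>x\<in>{1..l}. col x < k" and
    rainbow: "\<forall>E\<in>Pf. card E = k \<longrightarrow> (\<forall>i<k. card {x\<in>E. col x = i} = 1)"
    unfolding has_kpartite_rep_def by (elim exE conjE) (rule that; assumption)
  from sub obtain f where f: "inj_on f A" "f ` A \<subseteq> Pf"
    and mono: "\<forall>u\<in>A. \<forall>v\<in>A. le u v \<longrightarrow> f u \<subseteq> f v"
    unfolding weak_subposet_def by (elim exE conjE) (rule that; assumption)
  note f_mono = mono[rule_format]
  \<comment> \<open>Classes of size \<open>Suc l\<close> hold all \<open>l\<close> vertices and are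
    non-empty even if \<open>l = 0\<close>.\<close>
  obtain n0 where n0: "\<forall>(N::nat set) G. dense_pairs c N G \<longrightarrow> card N \<ge> n0 \<longrightarrow>
     (\<exists>D Xs. length Xs = k \<and> (\<forall>X\<in>set Xs. card X = Suc l) \<and>
        (\<forall>ys. list_all2 (\<in>) ys Xs \<longrightarrow> good G D ys))"
    using ex_good_blowup[OF c, of "Suc l" k] by blast
  show ?thesis
  proof (intro exI[of _ n0] allI impI notI)
    fix N :: "nat set" and F G
    assume free: "P_free A le F" and F: "finite F" "card A \<le> card F" and GF: "G \<subseteq> F"
      and N: "n0 \<le> card N" and dense: "dense_pairs c N G"
    obtain D Xs where Xs: "length Xs = k" "\<forall>X\<in>set Xs. card X = Suc l"
      and good: "\<And>ys. list_all2 (\<in>) ys Xs \<Longrightarrow> good G D ys"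
      using n0[rule_format, OF dense N] by blast
    obtain g where g: "inj_on g {1..l}" "D \<inter> g ` {1..l} = {}"
      and gE: "\<And>E. E \<subseteq> {1..l} \<Longrightarrow> \<forall>i<k. card {x\<in>E. col x = i} = 1 \<Longrightarrow>
         D \<union> g ` E \<in> G \<and> (\<forall>v\<in>E. D \<union> g ` (E - {v}) \<in> G)"
      using ex_rainbow_embedding[OF good Xs, of "{1..l}" col] col by auto
    define \<phi> where "\<phi> S = D \<union> g ` S" for S
    have \<phi>_inj: "S = T" if "S \<subseteq> {1..l}" "T \<subseteq> {1..l}" "\<phi> S = \<phi> T" for S T
    proof -
      have "D \<inter> g ` S = {}" "D \<inter> g ` T = {}" using g(2) that by blast+
      then have "g ` S = g ` T" using that(3) unfolding \<phi>_def by blast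
      then show ?thesis using inj_on_image_eq_iff[OF g(1) that(1,2)] by simp
    qed
    have fl: "f u \<subseteq> {1..l}" "card (f u) = k - 1 \<or> card (f u) = k" if "u \<in> A" for u
      using f(2) Pf that by auto
    define B where "B = {u\<in>A. \<phi> (f u) \<in> F}"
    \<comment> \<open>Elements outside \<open>B\<close> are isolated, so they may be sent anywhere.\<close>
    have comparable: "u \<in> B \<and> v \<in> B \<and> \<phi> (f u) \<subseteq> \<phi> (f v)"
      if uv: "u \<in> A" "v \<in> A" "u \<noteq> v" "le u v" for u v
    proof -
      have sub: "f u \<subset> f v" using f_mono[OF uv(1,2,4)] uv f(1) by (auto simp: inj_on_def)
      have fin: "finite (f v)" using fl(1)[OF uv(2)] finite_subset by blast
      have "card (f u) < card (f v)" using sub fin by (rule psubset_card_mono[rotated])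
      then have cards: "card (f v) = k" "card (f u) = k - 1" using fl(2)[OF uv(1)] fl(2)[OF uv(2)] by auto
      \<comment> \<open>As \<open>k \<ge> 1\<close>, the sizes \<open>k\<close> and
        \<open>k - 1\<close> differ by exactly one, so \<open>f u\<close> is the edge
        \<open>f v\<close> without one vertex.\<close>
      have "card (f v - f u) = 1"
        using cards fin k card_Diff_subset[of "f u" "f v"] finite_subset[of "f u" "f v"] sub by auto
      then obtain x where x: "f v - f u = {x}" by (auto simp: card_1_singleton_iff)
      then have fu: "f u = f v - {x}" "x \<in> f v" using sub by auto
      have "f v \<in> Pf" using f(2) uv(2) by auto
      then have "\<forall>i<k. card {x\<in>f v. col x = i} = 1" using rainbow cards(1) by blast
      from gE[OF fl(1)[OF uv(2)] this] have "\<phi> (f v) \<in> F" "\<phi> (f u) \<in> F"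
        using fu GF unfolding \<phi>_def by auto
      then show ?thesis using uv sub unfolding B_def \<phi>_def by auto
    qed
    have "inj_on (\<lambda>u. \<phi> (f u)) B"
    proof (rule inj_onI)
      fix u v assume "u \<in> B" "v \<in> B" "\<phi> (f u) = \<phi> (f v)"
      then have "u \<in> A" "v \<in> A" "f u = f v" using \<phi>_inj fl(1) unfolding B_def by auto
      then show "u = v" using f(1) by (auto simp: inj_on_def)
    qed
    moreover have "B \<subseteq> A" "(\<lambda>u. \<phi> (f u)) ` B \<subseteq> F" unfolding B_def by auto
    ultimately obtain h where h: "inj_on h A" "h ` A \<subseteq> F" "\<forall>u\<in>B. h u = \<phi> (f u)"
      using inj_on_extend[OF A F, of B "\<lambda>u. \<phi> (f u)"] by auto
    have "h u \<subseteq> h v" if "u \<in> A" "v \<in> A" "le u v" for u v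
      using comparable[of u v] that h(3) by (cases "u = v") auto
    then have "weak_subposet A le F (\<subseteq>)"
      using h unfolding weak_subposet_def by (intro exI[of _ h]) simp
    then show False using free unfolding P_free_def by simp
  qed
qed

section \<open>Posets of height two\<close>

lemma finite_card_chains:
  assumes "finite A" shows "finite {card C | C. is_chain A le C}"
  by (rule finite_subset[of _ "card ` Pow A"]) (use assms in \<open>auto simp: is_chain_def\<close>)

lemma card_chain_le_height:
  assumes "finite A" "is_chain A le C" shows "card C \<le> height A le"
  unfolding height_def by (rule Max_ge[OF finite_card_chains[OF assms(1)]]) (use assms(2) in auto)

lemma ex_chain_of_height:
  assumes "finite A" shows "\<exists>C. is_chain A le C \<and> card C = height A le"
proof -
  have "height A le \<in> {card C | C. is_chain A le C}"
    unfolding height_def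
  proof (rule Max_in)
    show "finite {card C |C. is_chain A le C}" by (rule finite_card_chains[OF assms])
    show "{card C |C. is_chain A le C} \<noteq> {}" by (auto simp: is_chain_def)
  qed
  then show ?thesis by auto
qed

lemma height2_no_chain3:
  assumes A: "finite A" "poset_on A le" "height A le = 2"
    and uvw: "u \<in> A" "v \<in> A" "w \<in> A" "le u v" "le v w" "u \<noteq> v" "v \<noteq> w"
  shows False
proof -
  have "le u w" "u \<noteq> w" "le u u" "le v v" "le w w" using A(2) uvw unfolding poset_on_def by blast+
  then have "is_chain A le {u, v, w}" using uvw unfolding is_chain_def by auto
  then have "card {u, v, w} \<le> 2" using card_chain_le_height[OF A(1)] A(3) by metis
  then show False using uvw \<open>u \<noteq> w\<close> by auto
qed

lemma height2_ex_comparable: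
  assumes "finite A" "height A le = 2"
  shows "\<exists>u\<in>A. \<exists>v\<in>A. u \<noteq> v \<and> le u v"
proof -
  obtain C where C: "is_chain A le C" "card C = 2" using ex_chain_of_height[OF assms(1)] assms(2) by metis
  then obtain u v where "C = {u, v}" "u \<noteq> v" by (auto simp: card_2_iff)
  then have "u \<in> A" "v \<in> A" "le u v \<or> le v u" using C(1) unfolding is_chain_def by auto
  then show ?thesis using \<open>u \<noteq> v\<close> by metis
qed

text \<open>Every strict relation is routed through \<open>Y\<close>: non-maximal elements go to
  sets below \<open>Y\<close>, maximal ones to sets above. Height two makes the upper end of a
  strict relation maximal. The factor 2 leaves \<open>card A\<close> sets above \<open>Y\<close>
  once those used by \<open>d\<close> are discarded.\<close>

lemma P_free_few_below_or_above:
  assumes A: "finite A" "poset_on A le" "height A le = 2" and F: "finite F" and free: "P_free A le F"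
    and below: "card {Z\<in>F. Z \<subseteq> Y} \<ge> 2 * card A" and above: "card {Z\<in>F. Y \<subseteq> Z} \<ge> 2 * card A"
  shows False
proof -
  obtain d where d: "d ` A \<subseteq> {Z\<in>F. Z \<subseteq> Y}" "inj_on d A"
    using card_le_inj[of A "{Z\<in>F. Z \<subseteq> Y}"] A F below by auto
  have "card {Z\<in>F. Y \<subseteq> Z} - card (d ` A) \<le> card ({Z\<in>F. Y \<subseteq> Z} - d ` A)"
    using A(1) by (intro diff_card_le_card_Diff) auto
  then have "card A \<le> card ({Z\<in>F. Y \<subseteq> Z} - d ` A)" using above d(2) by (simp add: card_image)
  then obtain e where e: "e ` A \<subseteq> {Z\<in>F. Y \<subseteq> Z} - d ` A" "inj_on e A"
    using card_le_inj[of A "{Z\<in>F. Y \<subseteq> Z} - d ` A"] A F by auto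
  define f where "f u = (if \<exists>v\<in>A. u \<noteq> v \<and> le u v then d u else e u)" for u
  have "inj_on f A"
  proof (rule inj_onI)
    fix u v assume uv: "u \<in> A" "v \<in> A" "f u = f v"
    have "d x \<noteq> e y" if "x \<in> A" "y \<in> A" for x y
    proof -
      have "e y \<in> {Z\<in>F. Y \<subseteq> Z} - d ` A" using e(1) that(2) by (rule subsetD[OF _ imageI])
      then show ?thesis using that(1) by auto
    qed
    from this[OF uv(1,2)] this[OF uv(2,1)] have "d u \<noteq> e v" "e u \<noteq> d v" by auto
    then have "d u = d v \<or> e u = e v" using uv(3) unfolding f_def by (metis (full_types))
    then show "u = v" using uv(1,2) inj_onD[OF d(2)] inj_onD[OF e(2)] by blast
  qed
  moreover have "f ` A \<subseteq> F" using d e unfolding f_def by auto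
  moreover have "f u \<subseteq> f v" if uv: "u \<in> A" "v \<in> A" "le u v" for u v
  proof (cases "u = v")
    case False
    then have "f u = d u" using uv unfolding f_def by auto
    moreover have "f v = e v" using height2_no_chain3[OF A uv(1,2) _ uv(3)] False unfolding f_def by auto
    ultimately show ?thesis using d e uv by blast
  qed simp
  ultimately have "weak_subposet A le F (\<subseteq>)"
    unfolding weak_subposet_def by (intro exI[of _ f]) simp
  then show False using free unfolding P_free_def by simp
qed

section \<open>Averages over maximal chains\<close>

text \<open>The expected sum of \<open>\<phi>\<close> over the members of a uniformly random maximal chain from \<open>Y\<close> to \<open>N\<close>.\<close>

definition chain_avg :: "'a set \<Rightarrow> ('a set \<Rightarrow> real) \<Rightarrow> 'a set \<Rightarrow> real" where
  "chain_avg N \<phi> Y = (\<Sum>Z | Y \<subseteq> Z \<and> Z \<subseteq> N. \<phi> Z / real ((card N - card Y) choose (card Z - card Y)))"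

text \<open>At \<open>Y = {}\<close> this is the Lubell function of \<open>F\<close>.\<close>

abbreviation lubell :: "'a set \<Rightarrow> 'a set set \<Rightarrow> 'a set \<Rightarrow> real" where
  "lubell N F \<equiv> chain_avg N (\<lambda>Z. of_bool (Z \<in> F))"

lemma chain_avg_top: "chain_avg N \<phi> N = \<phi> N"
proof -
  have "{Z. N \<subseteq> Z \<and> Z \<subseteq> N} = {N}" by auto
  then show ?thesis unfolding chain_avg_def by simp
qed

text \<open>A random chain from \<open>Y\<close> first adds a uniformly random \<open>x\<close>. In
  weights: a set \<open>Z\<close> with \<open>j\<close> elements outside \<open>Y\<close> is met for
  \<open>j\<close> choices of \<open>x\<close>, and
  \<open>j / (d - 1 choose j - 1) = d / (d choose j)\<close> with
  \<open>d = card (N - Y)\<close>.\<close>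

lemma chain_avg_rec:
  assumes N: "finite N" and Y: "Y \<subset> N"
  shows "chain_avg N \<phi> Y = \<phi> Y + (\<Sum>x\<in>N - Y. chain_avg N \<phi> (insert x Y)) / real (card (N - Y))"
proof -
  define d where "d = card N - card Y"
  have fin: "finite Y" using N Y finite_subset by blast
  have cardYN: "card Y < card N" using N Y by (rule psubset_card_mono)
  have d: "d > 0" "card (N - Y) = d" using cardYN fin Y unfolding d_def by (auto simp: card_Diff_subset)
  define S where "S = {Z. Y \<subset> Z \<and> Z \<subseteq> N}"
  have finS: "finite S" using N unfolding S_def by (auto intro: rev_finite_subset[of "Pow N"])
  have "(\<Sum>x\<in>N - Y. chain_avg N \<phi> (insert x Y)) =
      (\<Sum>x\<in>N - Y. \<Sum>Z\<in>{Z\<in>S. x \<in> Z}. \<phi> Z / real ((d - 1) choose (card Z - card Y - 1)))"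
  proof (rule sum.cong[OF refl])
    fix x assume x: "x \<in> N - Y"
    have "{Z. insert x Y \<subseteq> Z \<and> Z \<subseteq> N} = {Z\<in>S. x \<in> Z}" using x unfolding S_def by auto
    moreover have "card (insert x Y) = Suc (card Y)" using x fin by simp
    ultimately show "chain_avg N \<phi> (insert x Y) =
        (\<Sum>Z\<in>{Z\<in>S. x \<in> Z}. \<phi> Z / real ((d - 1) choose (card Z - card Y - 1)))"
      unfolding chain_avg_def d_def by simp
  qed
  also have "\<dots> = (\<Sum>Z\<in>S. \<Sum>x\<in>{x\<in>N - Y. x \<in> Z}. \<phi> Z / real ((d - 1) choose (card Z - card Y - 1)))"
    using N finS by (intro sum.swap_restrict) auto
  also have "\<dots> = (\<Sum>Z\<in>S. real d * (\<phi> Z / real (d choose (card Z - card Y))))"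
  proof (rule sum.cong[OF refl])
    fix Z assume Z: "Z \<in> S"
    have finZ: "finite Z" using Z N finite_subset unfolding S_def by blast
    define j where "j = card Z - card Y"
    have YZ: "card Y < card Z" using Z finZ unfolding S_def by (auto intro: psubset_card_mono)
    have ZN: "card Z \<le> card N" using Z N unfolding S_def by (auto intro: card_mono)
    have "{x\<in>N - Y. x \<in> Z} = Z - Y" using Z unfolding S_def by auto
    then have card: "card {x\<in>N - Y. x \<in> Z} = j"
      using Z fin unfolding S_def j_def by (auto simp: card_Diff_subset)
    have j: "j > 0" "j \<le> d" using YZ ZN unfolding j_def d_def by auto
    have "real j * real (d choose j) = real d * real ((d - 1) choose (j - 1))"
      using times_binomial_minus1_eq[OF j(1), of d] by (metis of_nat_mult)
    moreover have "real (d choose j) > 0" "real ((d - 1) choose (j - 1)) > 0" using j by auto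
    ultimately have "real j / real ((d - 1) choose (j - 1)) = real d / real (d choose j)"
      by (simp add: field_simps)
    then have "real j * (\<phi> Z / real ((d - 1) choose (j - 1))) = real d * (\<phi> Z / real (d choose j))"
      by (metis (no_types) mult.commute times_divide_eq_left)
    then show "(\<Sum>x\<in>{x\<in>N - Y. x \<in> Z}. \<phi> Z / real ((d - 1) choose (card Z - card Y - 1))) =
        real d * (\<phi> Z / real (d choose (card Z - card Y)))"
      using card unfolding j_def by simp
  qed
  also have "\<dots> = real d * (\<Sum>Z\<in>S. \<phi> Z / real (d choose (card Z - card Y)))"
    by (simp add: sum_distrib_left)
  finally have "(\<Sum>x\<in>N - Y. chain_avg N \<phi> (insert x Y)) / real (card (N - Y)) =
      (\<Sum>Z\<in>S. \<phi> Z / real (d choose (card Z - card Y)))" using d by simp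
  moreover have "chain_avg N \<phi> Y = \<phi> Y + (\<Sum>Z\<in>S. \<phi> Z / real (d choose (card Z - card Y)))"
  proof -
    have "{Z. Y \<subseteq> Z \<and> Z \<subseteq> N} = insert Y S" using Y unfolding S_def by auto
    moreover have "Y \<notin> S" unfolding S_def by auto
    ultimately show ?thesis using finS unfolding chain_avg_def d_def by simp
  qed
  ultimately show ?thesis by simp
qed

text \<open>Induction on \<open>card (N - Y)\<close>, shaped to match the recursion
  \<open>chain_avg_rec\<close>.\<close>

lemma upward_induct [consumes 2, case_names top step]:
  assumes N: "finite N" and "Y \<subseteq> N"
    and top: "P N"
    and step: "\<And>Y. Y \<subset> N \<Longrightarrow> (\<And>x. x \<in> N - Y \<Longrightarrow> P (insert x Y)) \<Longrightarrow> P Y"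
  shows "P Y"
  using assms(2)
proof (induction "card (N - Y)" arbitrary: Y rule: less_induct)
  case less
  show ?case
  proof (cases "Y = N")
    case False
    show ?thesis
    proof (rule step)
      fix x assume x: "x \<in> N - Y"
      have "card (N - insert x Y) < card (N - Y)" using N x by (intro psubset_card_mono) auto
      then show "P (insert x Y)" using less x by auto
    qed (use False less in auto)
  qed (use top in simp)
qed

lemma chain_avg_nonneg: "(\<And>Z. \<phi> Z \<ge> 0) \<Longrightarrow> chain_avg N \<phi> Y \<ge> 0"
  unfolding chain_avg_def by (intro sum_nonneg) simp

lemma average_le_max:
  fixes f :: "'a \<Rightarrow> real"
  assumes "finite S" "S \<noteq> {}"
  shows "\<exists>x\<in>S. (\<Sum>x\<in>S. f x) / real (card S) \<le> f x"
proof (rule ccontr)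
  assume "\<not> ?thesis"
  then have "(\<Sum>x\<in>S. f x) < (\<Sum>x\<in>S. (\<Sum>x\<in>S. f x) / real (card S))"
    using assms by (intro sum_strict_mono) auto
  then show False using assms by simp
qed

text \<open>Following from each set an element \<open>x\<close> whose value is at least the average
  builds a chain with at least the expected number of members of \<open>F\<close>.\<close>

lemma lubell_le_chain_length:
  assumes N: "finite N" and Y: "Y \<subseteq> N"
  shows "\<exists>xs. sorted_wrt (\<subset>) xs \<and> set xs \<subseteq> {Z\<in>F. Y \<subseteq> Z} \<and> lubell N F Y \<le> real (length xs)"
  using N Y
proof (induction rule: upward_induct)
  case top
  show ?case
  proof (cases "N \<in> F")
    case True then show ?thesis by (intro exI[of _ "[N]"]) (simp add: chain_avg_top)
  next
    case False then show ?thesis by (intro exI[of _ "[]"]) (simp add: chain_avg_top)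
  qed
next
  case (step Y)
  have "finite (N - Y)" "N - Y \<noteq> {}" using N step by auto
  from average_le_max[OF this, of "\<lambda>x. lubell N F (insert x Y)"] obtain x where x: "x \<in> N - Y"
    "(\<Sum>x\<in>N - Y. lubell N F (insert x Y)) / real (card (N - Y)) \<le> lubell N F (insert x Y)" by blast
  from step.IH[OF x(1)] obtain xs where xs: "sorted_wrt (\<subset>) xs"
    "set xs \<subseteq> {Z\<in>F. insert x Y \<subseteq> Z}" "lubell N F (insert x Y) \<le> real (length xs)" by blast
  have le: "lubell N F Y \<le> of_bool (Y \<in> F) + real (length xs)"
    using chain_avg_rec[OF N step.hyps(1)] x(2) xs(3) by (simp add: order_trans[OF _ xs(3)])
  show ?case
  proof (cases "Y \<in> F")
    case True
    have "\<forall>Z\<in>set xs. Y \<subset> Z" using xs(2) x(1) by auto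
    then show ?thesis using True le xs by (intro exI[of _ "Y # xs"]) auto
  next
    case False
    then show ?thesis using le xs by (intro exI[of _ xs]) auto
  qed
qed

text \<open>A chain of \<open>2 * M\<close> members of \<open>F\<close> would have \<open>M\<close>
  of them below its entry at index \<open>M\<close> and \<open>M\<close> from that entry
  upwards.\<close>

lemma lubell_le:
  assumes N: "finite N" and F: "finite F" and Y: "Y \<subseteq> N" and M: "M > 0"
    and not_both: "\<And>Y. card {Z\<in>F. Z \<subseteq> Y} \<ge> M \<Longrightarrow> card {Z\<in>F. Y \<subseteq> Z} \<ge> M \<Longrightarrow> False"
  shows "lubell N F Y \<le> 2 * real M"
proof -
  obtain xs where xs: "sorted_wrt (\<subset>) xs" "set xs \<subseteq> {Z\<in>F. Y \<subseteq> Z}" "lubell N F Y \<le> real (length xs)"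
    using lubell_le_chain_length[OF N Y] by blast
  have "length xs < 2 * M"
  proof (rule ccontr)
    assume "\<not> length xs < 2 * M"
    then have len: "length xs \<ge> 2 * M" by simp
    have nth: "xs ! i \<subseteq> xs ! j" if "i \<le> j" "j < length xs" for i j
      using sorted_wrt_nth_less[OF xs(1), of i j] that by (cases "i = j") auto
    have inj: "inj_on (\<lambda>i. xs ! i) {..<length xs}"
      by (rule linorder_inj_onI) (use sorted_wrt_nth_less[OF xs(1)] in fastforce, auto)
    have mem: "xs ! i \<in> F" if "i < length xs" for i using xs(2) that nth_mem by blast
    have "{M..<2 * M} \<subseteq> {..<length xs}" "{..<M} \<subseteq> {..<length xs}" using len by auto
    then have "card ((\<lambda>i. xs ! i) ` {..<M}) = M" "card ((\<lambda>i. xs ! i) ` {M..<2*M}) = M"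
      using card_image[OF inj_on_subset[OF inj, of "{..<M}"]]
        card_image[OF inj_on_subset[OF inj, of "{M..<2*M}"]] by auto
    moreover have "card ((\<lambda>i. xs ! i) ` {..<M}) \<le> card {Z\<in>F. Z \<subseteq> xs ! M}"
      using F len M by (intro card_mono image_subsetI CollectI conjI mem nth) auto
    moreover have "card ((\<lambda>i. xs ! i) ` {M..<2*M}) \<le> card {Z\<in>F. xs ! M \<subseteq> Z}"
      using F len by (intro card_mono image_subsetI CollectI conjI mem nth) auto
    ultimately show False using not_both[of "xs ! M"] by simp
  qed
  then show ?thesis using xs(3) by linarith
qed

text \<open>The expectation of \<open>X \<le> 1 + (X choose 2)\<close>, where \<open>X\<close> counts the members of \<open>F\<close>
  on a random maximal chain above \<open>Y\<close>.\<close>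

lemma lubell_le_pairs:
  assumes N: "finite N" and Y: "Y \<subseteq> N"
  shows "lubell N F Y \<le> 1 + chain_avg N (\<lambda>A. of_bool (A \<in> F) * (lubell N F A - 1)) Y"
  using N Y
proof (induction rule: upward_induct)
  case top
  show ?case by (simp add: chain_avg_top)
next
  case (step Y)
  \<comment> \<open>For \<open>A\<close> in \<open>F\<close> this is the expected number of members
    strictly above \<open>A\<close>, so its chain average counts the pairs of members on the
    chain.\<close>
  define \<psi> where "\<psi> = (\<lambda>A. of_bool (A \<in> F) * (lubell N F A - 1))"
  have nonneg: "\<psi> A \<ge> 0" if "A \<subseteq> N" for A
  proof (cases "A \<in> F")
    case True
    have "lubell N F A \<ge> 1"
    proof (cases "A = N")
      case False
      then have "lubell N F A = 1 + (\<Sum>x\<in>N - A. lubell N F (insert x A)) / real (card (N - A))"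
        using chain_avg_rec[OF N, of A "\<lambda>Z. of_bool (Z \<in> F)"] that True by auto
      moreover have "(\<Sum>x\<in>N - A. lubell N F (insert x A)) / real (card (N - A)) \<ge> 0"
        by (intro divide_nonneg_nonneg sum_nonneg chain_avg_nonneg) auto
      ultimately show ?thesis by linarith
    qed (use True in \<open>simp add: chain_avg_top\<close>)
    then show ?thesis unfolding \<psi>_def by simp
  qed (simp add: \<psi>_def)
  have avg_nonneg: "chain_avg N \<psi> A \<ge> 0" for A
    unfolding chain_avg_def by (intro sum_nonneg divide_nonneg_nonneg nonneg) auto
  have "lubell N F Y \<le> 1 + chain_avg N \<psi> Y"
  proof (cases "Y \<in> F")
    case True
    \<comment> \<open>For \<open>Y\<close> in \<open>F\<close> the bottom term alone equals
      \<open>lubell N F Y - 1\<close>, and the remaining terms are non-negative; the other case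
      averages the induction hypothesis.\<close>
    have "chain_avg N \<psi> Y = \<psi> Y + (\<Sum>x\<in>N - Y. chain_avg N \<psi> (insert x Y)) / real (card (N - Y))"
      by (rule chain_avg_rec[OF N step.hyps(1)])
    moreover have "(\<Sum>x\<in>N - Y. chain_avg N \<psi> (insert x Y)) / real (card (N - Y)) \<ge> 0"
      by (intro divide_nonneg_nonneg sum_nonneg avg_nonneg) auto
    moreover have "\<psi> Y = lubell N F Y - 1" using True unfolding \<psi>_def by simp
    ultimately show ?thesis by linarith
  next
    case False
    have card: "card (N - Y) > 0" using N step.hyps(1) by (simp add: card_gt_0_iff psubset_imp_ex_mem) 
    have "lubell N F Y = (\<Sum>x\<in>N - Y. lubell N F (insert x Y)) / real (card (N - Y))"
      using chain_avg_rec[OF N step.hyps(1), of "\<lambda>Z. of_bool (Z \<in> F)"] False by simp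
    also have "\<dots> \<le> (\<Sum>x\<in>N - Y. 1 + chain_avg N \<psi> (insert x Y)) / real (card (N - Y))"
      using step.IH unfolding \<psi>_def by (intro divide_right_mono sum_mono) auto
    also have "\<dots> = 1 + (\<Sum>x\<in>N - Y. chain_avg N \<psi> (insert x Y)) / real (card (N - Y))"
      using card by (simp add: sum.distrib add_divide_distrib)
    also have "\<dots> = 1 + chain_avg N \<psi> Y"
      using chain_avg_rec[OF N step.hyps(1), of \<psi>] False unfolding \<psi>_def by simp
    finally show ?thesis .
  qed
  then show ?case unfolding \<psi>_def .
qed

section \<open>Sums over levels and covering pairs\<close>

lemma sum_cover_pairs_swap:
  fixes g :: "'a set \<Rightarrow> 'a \<Rightarrow> 'b::comm_monoid_add"
  assumes "finite N" "F \<subseteq> Pow N" "H \<subseteq> Pow N"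
  shows "(\<Sum>A\<in>F. \<Sum>x\<in>{x\<in>N - A. insert x A \<in> H}. g A x) =
         (\<Sum>B\<in>H. \<Sum>x\<in>{x\<in>B. B - {x} \<in> F}. g (B - {x}) x)"
proof -
  have fin: "finite F" "finite H" using assms by (auto intro: rev_finite_subset[of "Pow N"])
  have finB: "finite B" if "B \<in> H" for B
    using that assms by (auto intro: rev_finite_subset[of N])
  have "(\<Sum>A\<in>F. \<Sum>x\<in>{x\<in>N - A. insert x A \<in> H}. g A x) =
      (\<Sum>(A, x)\<in>(SIGMA A:F. {x\<in>N - A. insert x A \<in> H}). g A x)"
    using fin assms by (subst sum.Sigma) auto
  also have "\<dots> = (\<Sum>(B, x)\<in>(SIGMA B:H. {x\<in>B. B - {x} \<in> F}). g (B - {x}) x)"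
    by (rule sum.reindex_bij_witness[of _ "\<lambda>(B, x). (B - {x}, x)" "\<lambda>(A, x). (insert x A, x)"])
       (use assms in \<open>auto simp: insert_absorb\<close>)
  also have "\<dots> = (\<Sum>B\<in>H. \<Sum>x\<in>{x\<in>B. B - {x} \<in> F}. g (B - {x}) x)"
    using fin finB by (subst sum.Sigma) auto
  finally show ?thesis .
qed

lemma chain_avg_empty:
  assumes "finite N" "F \<subseteq> Pow N"
  shows "chain_avg N (\<lambda>A. of_bool (A \<in> F) * \<phi> A) {} = (\<Sum>A\<in>F. \<phi> A / real (card N choose card A))"
  unfolding chain_avg_def using assms
  by (intro sum.mono_neutral_cong_right) (auto intro: rev_finite_subset[of "Pow N"])

lemma lubell_empty:
  assumes "finite N" "F \<subseteq> Pow N"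
  shows "lubell N F {} = (\<Sum>A\<in>F. 1 / real (card N choose card A))"
  using chain_avg_empty[OF assms, of "\<lambda>_. 1"] by simp

text \<open>Both sides count the covering pairs between levels \<open>a\<close> and
  \<open>Suc a\<close>; the weight of a pair can therefore be normalised by either of its
  levels.\<close>

lemma choose_times_diff: "(n choose a) * (n - a) = (n choose Suc a) * Suc a"
  using binomial_absorb_comp[of n a] binomial_absorption[of a n] by (simp only: mult.commute)

lemma card_levels_le:
  fixes x d :: real
  assumes "d \<ge> 0"
  shows "finite {b::nat. \<bar>real b - x\<bar> \<le> d}" and "real (card {b::nat. \<bar>real b - x\<bar> \<le> d}) \<le> 2 * d + 1"
proof -
  define J where "J = {b::nat. \<bar>real b - x\<bar> \<le> d}"
  have "J \<subseteq> {..nat \<lceil>x + d\<rceil>}" unfolding J_def by (auto; linarith)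
  then show fin: "finite {b::nat. \<bar>real b - x\<bar> \<le> d}" unfolding J_def using finite_subset by blast
  show "real (card {b::nat. \<bar>real b - x\<bar> \<le> d}) \<le> 2 * d + 1"
  proof (cases "J = {}")
    case False
    define m where "m = Min J"
    have finJ: "finite J" using fin unfolding J_def .
    have mJ: "m \<in> J" unfolding m_def using finJ False by (rule Min_in)
    have "J \<subseteq> {m..m + nat \<lfloor>2 * d\<rfloor>}"
    proof
      fix b assume b: "b \<in> J"
      have "m \<le> b" unfolding m_def using finJ b by (rule Min_le)
      moreover have "real b - real m \<le> 2 * d" using b mJ unfolding J_def by auto
      ultimately show "b \<in> {m..m + nat \<lfloor>2 * d\<rfloor>}" by auto linarith
    qed
    then have "card J \<le> card {m..m + nat \<lfloor>2 * d\<rfloor>}" by (intro card_mono) auto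
    then have "real (card J) \<le> real (nat \<lfloor>2 * d\<rfloor>) + 1" by simp
    also have "\<dots> \<le> 2 * d + 1" using assms by simp
    finally show ?thesis unfolding J_def .
  next
    case True
    then show ?thesis using assms unfolding J_def by simp
  qed
qed

lemma sum_by_card:
  fixes g :: "'a set \<Rightarrow> real"
  assumes "finite N" "F \<subseteq> Pow N"
  shows "(\<Sum>A\<in>F. g A) = (\<Sum>a\<le>card N. \<Sum>A | A \<in> F \<and> card A = a. g A)"
proof -
  have "finite F" using assms by (auto intro: rev_finite_subset[of "Pow N"])
  then have "(\<Sum>a\<le>card N. \<Sum>A\<in>{A\<in>F. card A = a}. g A) = (\<Sum>A\<in>F. g A)"
    using assms by (intro sum.group) (auto intro: card_mono)
  then show ?thesis by simp
qed

text \<open>A full level has total weight one, and a level beyond \<open>card N\<close> is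
  empty.\<close>

lemma sum_levels_le_card:
  assumes N: "finite N" and J: "finite J"
  shows "(\<Sum>B | B \<subseteq> N \<and> card B \<in> J. 1 / real (card N choose card B)) \<le> real (card J)"
proof -
  define S where "S = {B. B \<subseteq> N \<and> card B \<in> J}"
  have S: "finite S" "S \<subseteq> Pow N" using N unfolding S_def by (auto intro: rev_finite_subset[of "Pow N"])
  have "(\<Sum>B\<in>S. 1 / real (card N choose card B)) =
      (\<Sum>b\<in>J. \<Sum>B\<in>{B\<in>S. card B = b}. 1 / real (card N choose card B))"
    using S J by (intro sum.group[symmetric]) (auto simp: S_def)
  also have "\<dots> \<le> (\<Sum>b\<in>J. 1)"
  proof (rule sum_mono)
    fix b assume b: "b \<in> J"
    have "{B\<in>S. card B = b} = {B. B \<subseteq> N \<and> card B = b}" using b unfolding S_def by auto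
    then have "card {B\<in>S. card B = b} = card N choose b" using N by (simp add: n_subsets)
    moreover have "(\<Sum>B\<in>{B\<in>S. card B = b}. 1 / real (card N choose card B)) =
        real (card {B\<in>S. card B = b}) / real (card N choose b)" by simp
    ultimately show "(\<Sum>B\<in>{B\<in>S. card B = b}. 1 / real (card N choose card B)) \<le> 1" by simp
  qed
  finally show ?thesis unfolding S_def by simp
qed

section \<open>Families in the middle layers\<close>

text \<open>Freeness is abstracted into \<open>not_both\<close>, with \<open>M\<close> twice the
  size of the poset in the application. The bound \<open>\<delta> \<le> 1 / 8\<close> keeps at least
  3/8 of the ground set both inside and outside every member of \<open>F\<close>.\<close>

locale middle_family =
  fixes N :: "'a set" and F :: "'a set set" and M :: nat and \<delta> :: real
  assumes N: "finite N" and FN: "F \<subseteq> Pow N" and M: "M > 0"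
    and \<delta>: "0 \<le> \<delta>" "\<delta> \<le> 1 / 8" and large: "card N \<ge> 16"
    and middle: "\<And>A. A \<in> F \<Longrightarrow> \<bar>real (card A) - real (card N) / 2\<bar> \<le> \<delta> * real (card N)"
    and not_both: "\<And>Y. card {Z\<in>F. Z \<subseteq> Y} \<ge> M \<Longrightarrow> card {Z\<in>F. Y \<subseteq> Z} \<ge> M \<Longrightarrow> False"
begin

abbreviation "n \<equiv> card N"

definition "upper_degree H A = card {x\<in>N - A. insert x A \<in> H}"

text \<open>By \<open>not_both\<close> such a set has fewer than \<open>M\<close> members of
  \<open>F\<close> below it, so few covering pairs lead from \<open>F\<close> into
  \<open>high\<close>.\<close>

definition "high = {Y. Y \<subseteq> N \<and> card {Z\<in>F. Y \<subseteq> Z} \<ge> M}"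

lemma finF: "finite F" using N FN by (auto intro: rev_finite_subset[of "Pow N"])

lemma fin: "A \<in> F \<Longrightarrow> finite A" using N FN by (auto intro: rev_finite_subset[of N])

lemma level:
  assumes "A \<in> F"
  shows "3 * real n / 8 \<le> real (card A)" "real (card A) \<le> 5 * real n / 8" "card A < n"
proof -
  have "\<delta> * real n \<le> 1 / 8 * real n" using \<delta> by (intro mult_right_mono) auto
  then show "3 * real n / 8 \<le> real (card A)" and *: "real (card A) \<le> 5 * real n / 8"
    using middle[OF assms] by auto
  then show "card A < n" using large by linarith
qed

lemma lubell_le_M: "Y \<subseteq> N \<Longrightarrow> lubell N F Y \<le> 2 * real M"
  by (rule lubell_le[OF N finF _ M not_both])

text \<open>Fewer than \<open>M\<close> members of \<open>F\<close> lie above the set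
  \<open>Y = insert x A\<close>. Those other than \<open>Y\<close> lie strictly between
  \<open>Y\<close> and \<open>N\<close>, so their weight is at most the reciprocal of
  \<open>n - card Y\<close>, which is at least \<open>n / 4\<close>.\<close>

lemma lubell_not_high:
  assumes A: "A \<in> F" and x: "x \<in> N - A" and nh: "insert x A \<notin> high"
  shows "lubell N F (insert x A) \<le> of_bool (insert x A \<in> F) + 4 * real M / real n"
proof -
  define Y where "Y = insert x A"
  define S where "S = {Z\<in>F. Y \<subseteq> Z}"
  have YN: "Y \<subseteq> N" using A FN x unfolding Y_def by auto
  have S: "finite S" "card S < M" using finF nh YN unfolding S_def high_def Y_def by auto
  have cardY: "card Y = Suc (card A)" using x fin[OF A] unfolding Y_def by simp
  have term_le: "1 / real ((n - card Y) choose (card Z - card Y)) \<le> 4 / real n"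
    if Z: "Z \<in> S" "Z \<noteq> Y" for Z
  proof -
    have ZF: "Z \<in> F" "Y \<subset> Z" using Z unfolding S_def by auto
    have "card Y < card Z" using ZF fin by (intro psubset_card_mono) auto
    moreover have "card Z < n" using level(3)[OF ZF(1)] .
    ultimately have "n - card Y \<le> (n - card Y) choose (card Z - card Y)"
      by (intro upper_le_binomial) auto
    moreover have "real n / 4 \<le> real (n - card Y)"
      using level[OF A] cardY large by (simp add: of_nat_diff)
    ultimately have "real n / 4 \<le> real ((n - card Y) choose (card Z - card Y))" by linarith
    moreover have "real n / 4 > 0" using large by simp
    ultimately have "1 / real ((n - card Y) choose (card Z - card Y)) \<le> 1 / (real n / 4)"
      by (intro frac_le) simp_all
    then show ?thesis by simp
  qed
  have "lubell N F Y = (\<Sum>Z\<in>S. 1 / real ((n - card Y) choose (card Z - card Y)))"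
    unfolding chain_avg_def S_def using N FN
    by (intro sum.mono_neutral_cong_right) (auto intro: rev_finite_subset[of "Pow N"])
  also have "\<dots> \<le> (\<Sum>Z\<in>S. of_bool (Z = Y) + 4 / real n)"
    using term_le by (intro sum_mono) auto
  also have "\<dots> = real (card (S \<inter> {Y})) + real (card S) * (4 / real n)"
    using S(1) by (simp add: sum.distrib)
  also have "\<dots> \<le> of_bool (Y \<in> F) + real M * (4 / real n)"
    using S large by (intro add_mono mult_right_mono) (auto simp: S_def)
  finally show ?thesis unfolding Y_def by (simp add: mult.commute)
qed

lemma lubell_insert_le:
  assumes A: "A \<in> F" and x: "x \<in> N - A"
  shows "lubell N F (insert x A) \<le>
    of_bool (insert x A \<in> F) + 4 * real M / real n + 2 * real M * of_bool (insert x A \<in> high)"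
proof (cases "insert x A \<in> high")
  case True
  moreover have "lubell N F (insert x A) \<le> 2 * real M" using lubell_le_M A FN x by auto
  moreover have "(0::real) \<le> of_bool (insert x A \<in> F)" "0 \<le> 4 * real M / real n" by auto
  moreover have "2 * real M * of_bool (insert x A \<in> high) = 2 * real M" using True by simp
  ultimately show ?thesis by linarith
qed (use lubell_not_high[OF A x] in auto)

text \<open>Conditioning on the first step above \<open>A\<close>: the set \<open>A\<close> itself
  accounts for the subtracted 1, and each upper cover is bounded by
  \<open>lubell_insert_le\<close>.\<close>

lemma lubell_excess_le:
  assumes A: "A \<in> F"
  shows "lubell N F A - 1 \<le> real (upper_degree F A) / real (n - card A) + 4 * real M / real n
     + 2 * real M * (real (upper_degree high A) / real (n - card A))"
proof -
  have AN: "A \<subset> N" using A FN level(3)[OF A] by auto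
  have card: "card (N - A) = n - card A" "n - card A > 0"
    using AN fin[OF A] level(3)[OF A] by (auto simp: card_Diff_subset)
  have finNA: "finite (N - A)" using N by simp
  have bools: "(\<Sum>x\<in>N - A. of_bool (insert x A \<in> H)) = real (upper_degree H A)" for H
    unfolding upper_degree_def using finNA by (simp add: Int_def)
  have "lubell N F A - 1 = (\<Sum>x\<in>N - A. lubell N F (insert x A)) / real (n - card A)"
    using chain_avg_rec[OF N AN, of "\<lambda>Z. of_bool (Z \<in> F)"] A card by simp
  also have "\<dots> \<le> (\<Sum>x\<in>N - A. of_bool (insert x A \<in> F) + 4 * real M / real n
      + 2 * real M * of_bool (insert x A \<in> high)) / real (n - card A)"
    using lubell_insert_le[OF A] by (intro divide_right_mono sum_mono) auto
  also have "\<dots> = (real (upper_degree F A) + real (n - card A) * (4 * real M / real n)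
      + 2 * real M * real (upper_degree high A)) / real (n - card A)"
    unfolding sum.distrib sum_distrib_left[symmetric] bools using card by simp
  finally show ?thesis using card(2) by (simp add: add_divide_distrib)
qed

text \<open>Counted from the upper set of each pair: a high set has few members of \<open>F\<close> below it.\<close>

lemma high_pairs_le:
  "(\<Sum>A\<in>F. real (upper_degree high A) / real ((n choose card A) * (n - card A)))
     \<le> 8 * real M * \<delta> + 4 * real M / real n"
proof -
  define g where "g A = 1 / real ((n choose card A) * (n - card A))" for A :: "'a set"
  \<comment> \<open>These are the possible levels of the upper set of a pair, hence the shift by one
    against the range of \<open>F\<close>.\<close>
  define J where "J = {b::nat. \<bar>real b - (real n / 2 + 1)\<bar> \<le> \<delta> * real n}"
  have J: "finite J" "real (card J) \<le> 2 * (\<delta> * real n) + 1"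
    unfolding J_def using card_levels_le[of "\<delta> * real n"] \<delta> by auto
  have highN: "high \<subseteq> Pow N" unfolding high_def by auto
  have finhigh: "finite high" using highN N by (auto intro: rev_finite_subset[of "Pow N"])
  have "(\<Sum>A\<in>F. real (upper_degree high A) / real ((n choose card A) * (n - card A)))
      = (\<Sum>A\<in>F. \<Sum>x\<in>{x\<in>N - A. insert x A \<in> high}. g A)"
    unfolding upper_degree_def g_def by simp
  also have "\<dots> = (\<Sum>B\<in>high. \<Sum>x\<in>{x\<in>B. B - {x} \<in> F}. g (B - {x}))"
    by (rule sum_cover_pairs_swap[OF N FN highN])
  also have "\<dots> \<le> (\<Sum>B\<in>high. if card B \<in> J then 4 * real M / real n * (1 / real (n choose card B)) else 0)"
  proof (rule sum_mono)
    fix B assume B: "B \<in> high"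
    have finB: "finite B" using B highN N by (auto intro: rev_finite_subset[of N])
    define D where "D = {x\<in>B. B - {x} \<in> F}"
    show "(\<Sum>x\<in>D. g (B - {x})) \<le> (if card B \<in> J then 4 * real M / real n * (1 / real (n choose card B)) else 0)"
    proof (cases "D = {}")
      case False
      then obtain y where y: "y \<in> B" "B - {y} \<in> F" unfolding D_def by auto
      define b where "b = card B"
      have b: "card (B - {x}) = b - 1" "b > 0" if "x \<in> B" for x
        using that finB unfolding b_def by (auto simp: card_gt_0_iff)
      have bJ: "b \<in> J" using middle[OF y(2)] b[OF y(1)] unfolding J_def by (auto simp: of_nat_diff)
      have bn: "real n / 4 \<le> real b" using level(1)[OF y(2)] b[OF y(1)] by (simp add: of_nat_diff)
      have "b \<le> n" unfolding b_def using B highN N by (auto intro: card_mono)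
      then have chooseb: "real (n choose b) > 0" by simp
      \<comment> \<open>The weight, normalised by the level of the lower set, is rewritten in terms
        of the level of \<open>B\<close>.\<close>
      have "g (B - {x}) = 1 / (real (n choose b) * real b)" if "x \<in> D" for x
        using choose_times_diff[of n "b - 1"] b[of x] that unfolding D_def g_def by (metis (no_types, lifting) Suc_pred' mem_Collect_eq of_nat_mult)
      then have "(\<Sum>x\<in>D. g (B - {x})) = real (card D) * (1 / (real (n choose b) * real b))" by simp
      also have "\<dots> \<le> real M * (1 / (real (n choose b) * (real n / 4)))"
      proof (intro mult_mono divide_left_mono)
        have "inj_on (\<lambda>x. B - {x}) D" unfolding D_def inj_on_def by blast
        then have "card D \<le> card {Z\<in>F. Z \<subseteq> B}"
          using finF by (intro card_inj_on_le[of "\<lambda>x. B - {x}"]) (auto simp: D_def)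
        also have "\<dots> < M" using not_both[of B] B unfolding high_def by fastforce
        finally show "real (card D) \<le> real M" by simp
      qed (use chooseb bn large in \<open>auto intro!: mult_pos_pos\<close>)
      also have "\<dots> = 4 * real M / real n * (1 / real (n choose b))" by (simp add: mult.commute)
      finally show ?thesis using bJ unfolding b_def by simp
    qed simp
  qed
  also have "\<dots> = (\<Sum>B\<in>{B\<in>high. card B \<in> J}. 4 * real M / real n * (1 / real (n choose card B)))"
    by (rule sum.inter_filter[OF finhigh, symmetric])
  also have "\<dots> \<le> (\<Sum>B | B \<subseteq> N \<and> card B \<in> J. 4 * real M / real n * (1 / real (n choose card B)))"
    using highN N by (intro sum_mono2) (auto intro: rev_finite_subset[of "Pow N"])
  also have "\<dots> = 4 * real M / real n * (\<Sum>B | B \<subseteq> N \<and> card B \<in> J. 1 / real (n choose card B))"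
    by (simp add: sum_distrib_left)
  \<comment> \<open>At most \<open>2 * \<delta> * n + 1\<close> levels occur, each of weight at most
    one.\<close>
  also have "\<dots> \<le> 4 * real M / real n * (2 * (\<delta> * real n) + 1)"
    using sum_levels_le_card[OF N J(1)] J(2) by (intro mult_left_mono) auto
  also have "\<dots> = 8 * real M * \<delta> + 4 * real M / real n" 
  proof -
    have "real n > 0" using large by linarith
    then show ?thesis by (simp add: field_simps)
  qed
  finally show ?thesis .
qed

text \<open>Each excess in \<open>lubell_le_pairs\<close> is bounded by
  \<open>lubell_excess_le\<close>. The uniform error \<open>4 * M / n\<close> gets multiplied by the
  Lubell value, which is at most \<open>2 * M\<close>; the high part is
  \<open>high_pairs_le\<close>.\<close>

lemma lubell_le_cover_pairs:
  "lubell N F {} \<le> 1 + (\<Sum>A\<in>F. real (upper_degree F A) / real ((n choose card A) * (n - card A)))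
     + 16 * (real M)\<^sup>2 * \<delta> + 16 * (real M)\<^sup>2 / real n"
proof -
  let ?w = "\<lambda>A. real (n choose card A)"
  have "lubell N F {} \<le> 1 + (\<Sum>A\<in>F. (lubell N F A - 1) / ?w A)"
    using lubell_le_pairs[OF N, of "{}" F] chain_avg_empty[OF N FN] by simp
  also have "(\<Sum>A\<in>F. (lubell N F A - 1) / ?w A) \<le> (\<Sum>A\<in>F. (real (upper_degree F A) / real (n - card A)
      + 4 * real M / real n + 2 * real M * (real (upper_degree high A) / real (n - card A))) / ?w A)"
    using lubell_excess_le by (intro sum_mono divide_right_mono) auto
  also have "\<dots> = (\<Sum>A\<in>F. real (upper_degree F A) / real ((n choose card A) * (n - card A))
      + 4 * real M / real n * (1 / ?w A)
      + 2 * real M * (real (upper_degree high A) / real ((n choose card A) * (n - card A))))"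
    by (intro sum.cong refl) (simp add: add_divide_distrib mult.commute)
  also have "\<dots> = (\<Sum>A\<in>F. real (upper_degree F A) / real ((n choose card A) * (n - card A)))
      + 4 * real M / real n * lubell N F {}
      + 2 * real M * (\<Sum>A\<in>F. real (upper_degree high A) / real ((n choose card A) * (n - card A)))"
    unfolding lubell_empty[OF N FN] by (simp only: sum.distrib sum_distrib_left)
  also have "\<dots> \<le> (\<Sum>A\<in>F. real (upper_degree F A) / real ((n choose card A) * (n - card A)))
      + 4 * real M / real n * (2 * real M) + 2 * real M * (8 * real M * \<delta> + 4 * real M / real n)"
    using lubell_le_M[of "{}"] high_pairs_le by (intro add_mono mult_left_mono order.refl) auto
  also have "\<dots> = (\<Sum>A\<in>F. real (upper_degree F A) / real ((n choose card A) * (n - card A)))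
     + 16 * (real M)\<^sup>2 * \<delta> + 16 * (real M)\<^sup>2 / real n"
    by (simp add: power2_eq_square algebra_simps)
  finally show ?thesis by simp
qed

text \<open>Two consecutive levels of \<open>F\<close> do not form a dense family, so they span at
  most \<open>c * n\<close> times their joint size in covering pairs. After normalisation each level
  is charged at most twice, with factor \<open>4 * c\<close>, and the normalised level sizes add up
  to the Lubell value.\<close>

lemma cover_pairs_le:
  assumes sparse: "\<And>G. G \<subseteq> F \<Longrightarrow> \<not> dense_pairs c N G" and c: "c > 0"
  shows "(\<Sum>A\<in>F. real (upper_degree F A) / real ((n choose card A) * (n - card A))) \<le> 16 * c * real M"
proof -
  define Fl where "Fl a = {A\<in>F. card A = a}" for a
  define r where "r a = real (card (Fl a)) / real (n choose a)" for a
  have Fl: "Fl a \<subseteq> F" "finite (Fl a)" "Fl a \<subseteq> Pow N" for a using finF FN unfolding Fl_def by auto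
  have r0: "r a \<ge> 0" for a unfolding r_def by simp
  have L: "(\<Sum>a\<le>n. r a) \<le> 2 * real M"
  proof -
    have "(\<Sum>a\<le>n. r a) = lubell N F {}"
      unfolding lubell_empty[OF N FN] sum_by_card[OF N FN] r_def Fl_def by simp
    then show ?thesis using lubell_le_M by simp
  qed
  have pairs: "(\<Sum>A\<in>Fl a. real (upper_degree F A)) \<le> c * real n * (real (card (Fl a)) + real (card (Fl (Suc a))))" for a
  proof -
    define G where "G = Fl a \<union> Fl (Suc a)"
    have G: "G \<subseteq> F" "finite G" using Fl unfolding G_def by auto
    have "(\<Sum>A\<in>Fl a. real (upper_degree F A)) = (\<Sum>A\<in>Fl a. \<Sum>x\<in>{x\<in>N - A. insert x A \<in> Fl (Suc a)}. 1)"
    proof (rule sum.cong[OF refl])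
      fix A assume A: "A \<in> Fl a"
      then have "{x\<in>N - A. insert x A \<in> F} = {x\<in>N - A. insert x A \<in> Fl (Suc a)}"
        using fin unfolding Fl_def by auto
      then show "real (upper_degree F A) = (\<Sum>x\<in>{x\<in>N - A. insert x A \<in> Fl (Suc a)}. 1)"
        unfolding upper_degree_def by simp
    qed
    also have "\<dots> = (\<Sum>B\<in>Fl (Suc a). \<Sum>x\<in>{x\<in>B. B - {x} \<in> Fl a}. 1)"
      by (rule sum_cover_pairs_swap[OF N Fl(3) Fl(3)])
    also have "\<dots> = (\<Sum>B\<in>Fl (Suc a). real (card {x\<in>B. B - {x} \<in> Fl a}))" by simp
    also have "\<dots> \<le> (\<Sum>B\<in>Fl (Suc a). real (card {x\<in>B. B - {x} \<in> G}))"
    proof (intro sum_mono of_nat_mono card_mono)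
      fix B assume "B \<in> Fl (Suc a)"
      then have "finite B" using fin Fl(1) by blast
      then show "finite {x\<in>B. B - {x} \<in> G}" by simp
    qed (auto simp: G_def)
    also have "\<dots> \<le> (\<Sum>B\<in>G. real (card {x\<in>B. B - {x} \<in> G}))"
      using G unfolding G_def by (intro sum_mono2) auto
    also have "\<dots> \<le> c * real n * real (card G)"
    proof (cases "G = {}")
      case False
      then show ?thesis using sparse[OF G(1)] G(1) FN N unfolding dense_pairs_def by auto
    qed simp
    also have "\<dots> \<le> c * real n * (real (card (Fl a)) + real (card (Fl (Suc a))))"
      using card_Un_le[of "Fl a" "Fl (Suc a)"] c unfolding G_def by (intro mult_left_mono) auto
    finally show ?thesis .
  qed
  have level_le: "(\<Sum>A\<in>Fl a. real (upper_degree F A)) / real ((n choose a) * (n - a)) \<le> 4 * c * (r a + r (Suc a))"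
    if a: "a < n" for a
  proof (cases "Fl a = {}")
    case True
    then show ?thesis using c r0[of a] r0[of "Suc a"] by simp
  next
    case False
    then obtain A where A: "A \<in> F" "card A = a" unfolding Fl_def by auto
    have na: "real n / 4 \<le> real (n - a)" "real n / 4 \<le> real (Suc a)"
      using level[OF A(1)] A(2) a by (auto simp: of_nat_diff)
    have pos: "real (n choose a) > 0" "real (n choose Suc a) > 0" "real n > 0" using a by auto
    have "(\<Sum>A\<in>Fl a. real (upper_degree F A)) / real ((n choose a) * (n - a))
        \<le> c * real n * (real (card (Fl a)) + real (card (Fl (Suc a)))) / real ((n choose a) * (n - a))"
      by (intro divide_right_mono pairs) auto
    \<comment> \<open>The share of level \<open>Suc a\<close> is normalised by that level
      instead.\<close>
    also have "\<dots> = c * real n * real (card (Fl a)) / (real (n choose a) * real (n - a))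
        + c * real n * real (card (Fl (Suc a))) / (real (n choose Suc a) * real (Suc a))"
      using arg_cong[OF choose_times_diff[of n a], of real] by (simp add: add_divide_distrib distrib_left)
    also have "\<dots> \<le> c * real n * real (card (Fl a)) / (real (n choose a) * (real n / 4))
        + c * real n * real (card (Fl (Suc a))) / (real (n choose Suc a) * (real n / 4))"
      using na pos c a by (intro add_mono divide_left_mono mult_left_mono mult_pos_pos) auto
    also have "\<dots> = 4 * c * (r a + r (Suc a))"
      unfolding r_def using pos by (simp add: field_simps)
    finally show ?thesis .
  qed
  have "(\<Sum>A\<in>F. real (upper_degree F A) / real ((n choose card A) * (n - card A)))
      = (\<Sum>a\<le>n. (\<Sum>A\<in>Fl a. real (upper_degree F A)) / real ((n choose a) * (n - a)))"
    unfolding sum_by_card[OF N FN] Fl_def sum_divide_distrib by (intro sum.cong refl) auto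
  \<comment> \<open>The term \<open>a = n\<close> vanishes: its denominator is zero, and so is the
    quotient by convention.\<close>
  also have "\<dots> = (\<Sum>a<n. (\<Sum>A\<in>Fl a. real (upper_degree F A)) / real ((n choose a) * (n - a)))"
    by (simp add: lessThan_Suc_atMost[symmetric])
  also have "\<dots> \<le> (\<Sum>a<n. 4 * c * (r a + r (Suc a)))"
    using level_le by (intro sum_mono) auto
  also have "\<dots> = 4 * c * ((\<Sum>a<n. r a) + (\<Sum>a<n. r (Suc a)))"
    by (simp add: sum_distrib_left[symmetric] sum.distrib)
  also have "\<dots> \<le> 4 * c * (2 * real M + 2 * real M)"
  proof (intro mult_left_mono add_mono)
    have "(\<Sum>a<n. r a) \<le> (\<Sum>a\<le>n. r a)" using r0 by (intro sum_mono2) auto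
    then show "(\<Sum>a<n. r a) \<le> 2 * real M" using L by linarith
    have "(\<Sum>a\<le>n. r a) = r 0 + (\<Sum>a<n. r (Suc a))" by (rule sum.atMost_shift)
    then show "(\<Sum>a<n. r (Suc a)) \<le> 2 * real M" using L r0[of 0] by linarith
  qed (use c in auto)
  finally show ?thesis by simp
qed

end

section \<open>The asymptotic bound\<close>

text \<open>Hoeffding's inequality for the symmetric binomial distribution, with
  \<open>2 ^ n\<close> bounded by \<open>n + 1\<close> times the largest binomial
  coefficient.\<close>

lemma binomial_tail_le:
  assumes \<delta>: "\<delta> > 0" and n: "n > 0"
  shows "(\<Sum>i | i \<le> n \<and> \<bar>real i - real n / 2\<bar> > \<delta> * real n. real (n choose i))
    \<le> 2 * (real n + 1) * exp (- 2 * real n * \<delta>\<^sup>2) * real (n choose (n div 2))"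
proof -
  interpret binomial_distribution n "1 / 2" by unfold_locales auto
  define S where "S = {i. i \<le> n \<and> \<bar>real i - real n / 2\<bar> > \<delta> * real n}"
  have S: "finite S" unfolding S_def by simp
  have "(\<Sum>i\<in>S. real (n choose i)) / 2 ^ n = (\<Sum>i\<in>S. pmf (binomial_pmf n (1 / 2)) i)"
    unfolding sum_divide_distrib
  proof (rule sum.cong[OF refl])
    fix i assume "i \<in> S"
    then have "(1 / 2 :: real) ^ i * (1 / 2) ^ (n - i) = 1 / 2 ^ n"
      unfolding S_def by (simp add: power_add[symmetric] power_one_over)
    then show "real (n choose i) / 2 ^ n = pmf (binomial_pmf n (1 / 2)) i" by (simp add: mult.assoc)
  qed
  also have "\<dots> = measure_pmf.prob (binomial_pmf n (1 / 2)) S"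
    using S by (simp add: measure_measure_pmf_finite)
  also have "\<dots> \<le> measure_pmf.prob (binomial_pmf n (1 / 2)) {i. \<bar>real i / real n - 1 / 2\<bar> \<ge> \<delta>}"
  proof (rule measure_pmf.finite_measure_mono)
    show "S \<subseteq> {i. \<bar>real i / real n - 1 / 2\<bar> \<ge> \<delta>}"
    proof
      fix i assume "i \<in> S"
      then have "\<delta> * real n < \<bar>real i - real n / 2\<bar>" unfolding S_def by auto
      also have "real i - real n / 2 = (real i / real n - 1 / 2) * real n" using n by (simp add: field_simps)
      also have "\<bar>\<dots>\<bar> = \<bar>real i / real n - 1 / 2\<bar> * real n" by (simp add: abs_mult)
      finally show "i \<in> {i. \<bar>real i / real n - 1 / 2\<bar> \<ge> \<delta>}" using n by simp
    qed
  qed simp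
  also have "\<dots> \<le> 2 * exp (- 2 * real n * \<delta>\<^sup>2)"
    using prob_abs_ge'[OF n, of \<delta>] \<delta> by simp
  finally have "(\<Sum>i\<in>S. real (n choose i)) \<le> 2 ^ n * (2 * exp (- 2 * real n * \<delta>\<^sup>2))"
    by (simp add: field_simps)
  also have "\<dots> \<le> ((real n + 1) * real (n choose (n div 2))) * (2 * exp (- 2 * real n * \<delta>\<^sup>2))"
  proof (rule mult_right_mono)
    have "(2::nat) ^ n = (\<Sum>k\<le>n. n choose k)" by (simp add: choose_row_sum)
    also have "\<dots> \<le> (\<Sum>k\<le>n. n choose (n div 2))" by (intro sum_mono binomial_maximum)
    finally have "2 ^ n \<le> (n + 1) * (n choose (n div 2))" by simp
    then have "real (2 ^ n) \<le> real ((n + 1) * (n choose (n div 2)))" by (rule of_nat_mono)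
    then show "2 ^ n \<le> (real n + 1) * real (n choose (n div 2))" by (simp add: algebra_simps)
  qed simp
  also have "\<dots> = 2 * (real n + 1) * exp (- 2 * real n * \<delta>\<^sup>2) * real (n choose (n div 2))"
    by (simp only: mult_ac)
  finally show ?thesis unfolding S_def .
qed

lemma card_outside_middle_le:
  fixes \<delta> :: real
  assumes N: "finite N"
  shows "real (card {B. B \<subseteq> N \<and> \<bar>real (card B) - real (card N) / 2\<bar> > \<delta> * real (card N)})
    = (\<Sum>i | i \<le> card N \<and> \<bar>real i - real (card N) / 2\<bar> > \<delta> * real (card N). real (card N choose i))"
proof -
  define I where "I = {i. i \<le> card N \<and> \<bar>real i - real (card N) / 2\<bar> > \<delta> * real (card N)}"
  have "{B. B \<subseteq> N \<and> \<bar>real (card B) - real (card N) / 2\<bar> > \<delta> * real (card N)}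
      = (\<Union>i\<in>I. {B. B \<subseteq> N \<and> card B = i})"
    using N unfolding I_def by (auto intro: card_mono)
  also have "card \<dots> = (\<Sum>i\<in>I. card {B. B \<subseteq> N \<and> card B = i})"
    using N by (intro card_UN_disjoint) (auto simp: I_def intro: rev_finite_subset[of "Pow N"])
  also have "\<dots> = (\<Sum>i\<in>I. card N choose i)" using N by (simp add: n_subsets)
  finally show ?thesis unfolding I_def by simp
qed

section \<open>Free families and the extremal number\<close>

lemma P_free_subset: "P_free A le F \<Longrightarrow> F' \<subseteq> F \<Longrightarrow> P_free A le F'"
  unfolding P_free_def weak_subposet_def by (meson subset_trans)

lemma La_eq_Max: "La n A le = Max (card ` {F. F \<subseteq> Pow {1..n} \<and> P_free A le F})"
  unfolding La_def by (rule arg_cong[of _ _ Max]) auto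

lemma card_le_La: "F \<subseteq> Pow {1..n} \<Longrightarrow> P_free A le F \<Longrightarrow> card F \<le> La n A le"
  unfolding La_eq_Max by (intro Max_ge) auto

text \<open>The free family \<open>F0\<close> ensures that the maximum is taken over a non-empty
  set.\<close>

lemma La_attained:
  assumes "P_free A le F0" "F0 \<subseteq> Pow {1..n}"
  shows "\<exists>F \<subseteq> Pow {1..n}. P_free A le F \<and> card F = La n A le"
proof -
  have "La n A le \<in> card ` {F. F \<subseteq> Pow {1..n} \<and> P_free A le F}"
    unfolding La_eq_Max using assms by (intro Max_in) auto
  then obtain F where "F \<in> {F. F \<subseteq> Pow {1..n} \<and> P_free A le F}" "La n A le = card F" by (rule imageE)
  then show ?thesis by (intro exI[of _ F]) auto
qed

text \<open>An embedding would send \<open>u\<close> and \<open>v\<close> to distinct sets of equal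
  size, one inside the other.\<close>

lemma P_free_antichain:
  assumes "u \<in> A" "v \<in> A" "u \<noteq> v" "le u v" and card: "\<And>B. B \<in> F \<Longrightarrow> finite B \<and> card B = m"
  shows "P_free A le F"
  unfolding P_free_def weak_subposet_def
proof
  assume "\<exists>f. inj_on f A \<and> f ` A \<subseteq> F \<and> (\<forall>u\<in>A. \<forall>v\<in>A. le u v \<longrightarrow> f u \<subseteq> f v)"
  then obtain f where f: "inj_on f A" "f ` A \<subseteq> F" "\<forall>u\<in>A. \<forall>v\<in>A. le u v \<longrightarrow> f u \<subseteq> f v"
    by (elim exE conjE) (rule that; assumption)
  have "f u \<in> F" "f v \<in> F" using f(2) assms(1,2) by auto
  then have "finite (f v)" "card (f u) = card (f v)" using card by auto
  moreover have "f u \<subseteq> f v" using f(3) assms(1,2,4) by blast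
  ultimately have "f u = f v" by (simp add: card_subset_eq)
  then show False using f(1) assms(1-3) by (auto simp: inj_on_def)
qed

lemma middle_layer_free:
  assumes "u \<in> A" "v \<in> A" "u \<noteq> v" "le u v"
  shows "P_free A le {B. B \<subseteq> {1..n} \<and> card B = m}"
  by (rule P_free_antichain[of u A v le _ m]) (use assms in \<open>auto intro: finite_subset[OF _ finite_atLeastAtMost]\<close>)

text \<open>Members near the middle are bounded through the Lubell function, where each weighs at
  least the reciprocal of the middle binomial coefficient; the remaining ones fall under the tail
  bound.\<close>

lemma P_free_card_le:
  fixes A :: "'a set" and \<epsilon> :: real
  assumes A: "finite A" "poset_on A le" "height A le = 2" and k: "k \<ge> 2" and rep: "has_kpartite_rep A le k"
    and \<epsilon>: "\<epsilon> > 0"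
  shows "\<forall>\<^sub>F n in sequentially. \<forall>F \<subseteq> Pow {1..n}. P_free A le F \<longrightarrow>
    real (card F) \<le> (1 + \<epsilon>) * real (n choose (n div 2))"
proof -
  define M where "M = 2 * card A"
  have "A \<noteq> {}" using height2_ex_comparable[OF A(1,3)] by auto
  then have M: "M > 0" using A(1) unfolding M_def by (simp add: card_gt_0_iff)
  \<comment> \<open>The choices of \<open>c\<close> and \<open>\<delta>\<close> make
    \<open>16 * c * M\<close> and \<open>16 * M^2 * \<delta>\<close> at most
    \<open>\<epsilon> / 4\<close>. Large \<open>n\<close> does the same for
    \<open>16 * M^2 / n\<close> and for the share of the sets outside the middle.\<close>
  define c where "c = \<epsilon> / (64 * real M)"
  define \<delta> where "\<delta> = min (1 / 8) (\<epsilon> / (64 * (real M)\<^sup>2))"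
  have c: "c > 0" and \<delta>_pos: "\<delta> > 0" and \<delta>_le: "\<delta> \<le> 1 / 8" using \<epsilon> M unfolding c_def \<delta>_def by auto
  have cM: "16 * c * real M = \<epsilon> / 4" using M unfolding c_def by simp
  have \<delta>M: "16 * (real M)\<^sup>2 * \<delta> \<le> \<epsilon> / 4"
  proof -
    have "16 * (real M)\<^sup>2 * \<delta> \<le> 16 * (real M)\<^sup>2 * (\<epsilon> / (64 * (real M)\<^sup>2))"
      unfolding \<delta>_def by (intro mult_left_mono) auto
    also have "\<dots> = \<epsilon> / 4" using M by simp
    finally show ?thesis .
  qed
  have "k \<ge> 1" using k by simp
  from P_free_not_dense_pairs[OF A(1) rep this c] obtain n0 where
    sparse: "\<forall>N F G. P_free A le F \<longrightarrow> finite F \<longrightarrow> card A \<le> card F \<longrightarrow> G \<subseteq> F \<longrightarrow>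
     card N \<ge> n0 \<longrightarrow> \<not> dense_pairs c N G" by (elim exE)
  have "\<forall>\<^sub>F n in sequentially. n \<ge> n0 + card A + 16"
    by (rule eventually_ge_at_top)
  moreover have "\<forall>\<^sub>F n in sequentially. 16 * (real M)\<^sup>2 / real n \<le> \<epsilon> / 4"
    using \<epsilon> by real_asymp
  moreover have "\<forall>\<^sub>F n in sequentially. 2 * (real n + 1) * exp (- 2 * real n * \<delta>\<^sup>2) \<le> \<epsilon> / 4"
    using \<epsilon> \<delta>_pos by real_asymp
  ultimately show ?thesis
  proof eventually_elim
    case (elim n)
    define N where "N = {1..n}"
    have ground: "finite N" "card N = n" unfolding N_def by auto
    define C where "C = real (n choose (n div 2))"
    \<comment> \<open>This settles the families with fewer than \<open>card A\<close> members, in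
      which the embedding argument has no room for isolated elements.\<close>
    have "n \<le> n choose (n div 2)" using elim(1) by (intro upper_le_binomial) auto
    then have C: "C \<ge> real n" "C > 0" using elim(1) unfolding C_def by linarith+
    show ?case
    proof (intro allI impI)
      fix F assume F: "F \<subseteq> Pow {1..n}" and free: "P_free A le F"
      have F_sub: "F \<subseteq> Pow N" using F unfolding N_def .
      have finite_F: "finite F" using F_sub ground(1) by (auto intro: rev_finite_subset[of "Pow N"])
      define F' where "F' = {B\<in>F. \<bar>real (card B) - real n / 2\<bar> \<le> \<delta> * real n}"
      have F': "F' \<subseteq> F" "F' \<subseteq> Pow N" "finite F'" using F_sub finite_F unfolding F'_def by auto
      show "real (card F) \<le> (1 + \<epsilon>) * real (n choose (n div 2))"
      proof (cases "card A \<le> card F")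
        case False
        then have "real (card F) \<le> C" using C(1) elim(1) by linarith
        also have "\<dots> \<le> (1 + \<epsilon>) * C" using C(2) \<epsilon> by simp
        finally show ?thesis unfolding C_def .
      next
        case True
        interpret middle_family N F' M \<delta>
        proof
          fix Y
          assume *: "card {Z\<in>F'. Z \<subseteq> Y} \<ge> M" "card {Z\<in>F'. Y \<subseteq> Z} \<ge> M"
          show False
            using P_free_few_below_or_above[OF A F'(3) P_free_subset[OF free F'(1)], of Y] *
            unfolding M_def by blast
        qed (use ground F' M \<delta>_pos \<delta>_le elim(1) in \<open>auto simp: F'_def\<close>)
        \<comment> \<open>Freeness and the size condition are used for \<open>F\<close> rather than
          \<open>F'\<close>: isolated elements of the poset may be placed in any layer.\<close>
        have "\<not> dense_pairs c N G" if "G \<subseteq> F'" for G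
          using sparse[rule_format, OF free finite_F True, of G N] that F'(1) ground(2) elim(1) by auto
        from cover_pairs_le[OF this c]
        have "lubell N F' {} \<le> 1 + 16 * c * real M + 16 * (real M)\<^sup>2 * \<delta> + 16 * (real M)\<^sup>2 / real n"
          using lubell_le_cover_pairs ground(2) by simp
        also have "\<dots> \<le> 1 + \<epsilon> / 4 + \<epsilon> / 4 + \<epsilon> / 4" using cM \<delta>M elim(2) by linarith
        finally have L: "lubell N F' {} \<le> 1 + 3 * \<epsilon> / 4" by simp
        have "real (card F') / C = (\<Sum>B\<in>F'. 1 / C)" by simp
        also have "\<dots> \<le> (\<Sum>B\<in>F'. 1 / real (n choose card B))"
        proof (intro sum_mono frac_le)
          fix B assume "B \<in> F'"
          then have "card B \<le> n" using F'(2) ground card_mono[OF ground(1), of B] by auto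
          then show "0 < real (n choose card B)" by simp
          show "real (n choose card B) \<le> C" unfolding C_def by (intro of_nat_mono binomial_maximum)
        qed auto
        also have "\<dots> = lubell N F' {}" unfolding lubell_empty[OF ground(1) F'(2)] ground(2) ..
        finally have "real (card F') / C \<le> 1 + 3 * \<epsilon> / 4" using L by linarith
        then have "real (card F') \<le> (1 + 3 * \<epsilon> / 4) * C" using C(2) by (simp only: pos_divide_le_eq)
        moreover have "real (card (F - F')) \<le> \<epsilon> / 4 * C"
        proof -
          have "card (F - F') \<le> card {B. B \<subseteq> N \<and> \<bar>real (card B) - real n / 2\<bar> > \<delta> * real n}"
            using F_sub ground(1) by (intro card_mono) (auto simp: F'_def intro: rev_finite_subset[of "Pow N"])
          then have "real (card (F - F')) \<le> 2 * (real n + 1) * exp (- 2 * real n * \<delta>\<^sup>2) * C"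
            using card_outside_middle_le[OF ground(1), of \<delta>] binomial_tail_le[OF \<delta>_pos, of n] elim(1)
            unfolding C_def ground(2) by linarith
          also have "\<dots> \<le> \<epsilon> / 4 * C" using elim(3) C(2) by (intro mult_right_mono) auto
          finally show ?thesis .
        qed
        moreover have "card F = card F' + card (F - F')"
          using F' finite_F by (simp add: card_Diff_subset card_mono)
        ultimately show ?thesis unfolding C_def by (simp add: algebra_simps)
      qed
    qed
  qed
qed

theorem theorem2:
  fixes A :: "'a set" and le :: "'a \<Rightarrow> 'a \<Rightarrow> bool" and k :: nat
  assumes "finite A" and "poset_on A le"
    and "height A le = 2"
    and "k \<ge> 2" and "has_kpartite_rep A le k"
  shows "(\<lambda>n. real (La n A le) / real (n choose (n div 2))) \<longlonglongrightarrow> 1"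
proof (rule tendstoI)
  fix \<epsilon> :: real assume \<epsilon>: "\<epsilon> > 0"
  obtain u v where uv: "u \<in> A" "v \<in> A" "u \<noteq> v" "le u v"
    using height2_ex_comparable[OF assms(1,3)] by blast
  \<comment> \<open>Half of \<open>\<epsilon>\<close> makes the final distance strictly smaller than
    \<open>\<epsilon>\<close>.\<close>
  have "\<epsilon> / 2 > 0" using \<epsilon> by simp
  from P_free_card_le[OF assms this]
  show "\<forall>\<^sub>F n in sequentially. dist (real (La n A le) / real (n choose (n div 2))) 1 < \<epsilon>"
  proof eventually_elim
    case (elim n)
    define C where "C = real (n choose (n div 2))"
    have C: "C > 0" unfolding C_def by simp
    \<comment> \<open>The middle layer is free because \<open>A\<close> has a strict relation; it
      gives the lower bound and shows that the maximum defining \<open>La\<close> is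
      attained.\<close>
    define F0 where "F0 = {B. B \<subseteq> {1..n} \<and> card B = n div 2}"
    have F0: "P_free A le F0" "F0 \<subseteq> Pow {1..n}"
      unfolding F0_def using middle_layer_free[of u A v le n] uv by auto
    have "card F0 = n choose (n div 2)" unfolding F0_def by (simp add: n_subsets)
    then have lower: "C \<le> real (La n A le)" using card_le_La[OF F0(2,1)] unfolding C_def by simp
    obtain F where "F \<subseteq> Pow {1..n}" "P_free A le F" "card F = La n A le"
      using La_attained[OF F0] by blast
    then have upper: "real (La n A le) \<le> (1 + \<epsilon> / 2) * C" using elim unfolding C_def by metis
    have "1 \<le> real (La n A le) / C" "real (La n A le) / C \<le> 1 + \<epsilon> / 2"
      using lower upper C by (simp_all add: field_simps)
    then show ?case using \<epsilon> unfolding C_def dist_real_def by linarith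
  qed
qed

end
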